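(* Every finite dimensional simple $x$- and $y$-torsion $H$-module is isomorphic to $\overline{V}(\rho)$ for some character $\rho\in\widehat{G}$.
   Context: $\mathbb{K}$ is an algebraically closed field of characteristic zero, $G$ is a finitely generated abelian group, $\widehat{G}$ is the group of homomorphisms $G\to\mathbb{K}^\times$, $\chi\in\widehat{G}$ has finite order $n$, and $b,c\in G$ satisfy $\chi(b)=\chi(c)$ and $bc\neq1$. Put $e=c^{-1}-b\in\mathbb{K}[G]$. $H=H(G,\chi,\chi^{-1},b,c,1)$ is (after replacing its second Ore variable $y$ by $c^{-1}y$) the algebra generated by $G,x,y$ subject to the relations of $G$ and $xg=\chi(g)gx$, $yg=\chi(g)^{-1}gy$ $(g\in G)$, $yx=xy+e$; it has $\mathbb{K}$-basis $\{gx^iy^j\mid g\in G,\ i,j\ge 0\}$. Modules are left modules. Let $\sigma:\mathbb{K}[G]\to\mathbb{K}[G]$ be the automorphism with $\sigma(g)=\chi(g)g$, and for $u\in\mathbb{K}[G]$ let $[u]_i^\sigma=\sum_{k=0}^{i-1}\sigma^{-k}(u)$ for $i\ge1$, $[u]_0^\sigma=0$. Characters $\rho\in\widehat{G}$ are extended to algebra maps $\rho:\mathbb{K}[G]\to\mathbb{K}$. $V(\rho)$ is the $H$-module with basis $\{v_i\mid i\ge0\}$ and action $x\cdot v_i=v_{i+1}$, $g\cdot v_i=\rho(\sigma^{-i}(g))v_i$ for $g\in G$, $y\cdot v_0=0$, $y\cdot v_i=\rho([e]_i^\sigma)v_{i-1}$ for $i\ge1$. Since $\chi$ has order $n$, $[e]_n^\sigma=0$.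 Let $d$ be the least positive integer such that $\rho([e]_d^\sigma)=0$, and set $\overline{V}(\rho)=V(\rho)/Hv_d$, a $d$-dimensional module with basis the images of $v_0,\ldots,v_{d-1}$. A module is $x$-torsion if each of its elements is killed by some power $x^k$, $k\ge1$; similarly for $y$. *)

theory Defs
  imports
    "HOL-Library.Poly_Mapping"
    "HOL-Computational_Algebra.Group_Closure"
    "HOL-Algebra.QuotRing"
    "HOL-Algebra.Module"
    "HOL-Algebra.Multiplicative_Group"
    "HOL-Algebra.Algebraic_Closure_Type"
begin

section \<open>Left modules over a not necessarily commutative ring\<close>

text \<open>
  The record \<^type>\<open>module\<close> is reused for its scalar multiplication; its multiplicative
  fields \<^const>\<open>monoid.mult\<close> and \<^const>\<open>one\<close> play no role for modules. The locale \<^locale>\<open>Module.module\<close>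
  insists on a commutative ring of scalars, whence the following variant of it. The locale
  \<^locale>\<open>submodule\<close> has no such restriction.
\<close>

locale left_module = R?: ring R + M?: abelian_group M
  for R :: "('r, 'x) ring_scheme" (structure) and M :: "('r, 'm, 'y) module_scheme" (structure) +
  assumes smult_closed [simp, intro]:
      "\<lbrakk>a \<in> carrier R; u \<in> carrier M\<rbrakk> \<Longrightarrow> a \<odot>\<^bsub>M\<^esub> u \<in> carrier M"
    and smult_l_distr:
      "\<lbrakk>a \<in> carrier R; b \<in> carrier R; u \<in> carrier M\<rbrakk> \<Longrightarrow>
       (a \<oplus>\<^bsub>R\<^esub> b) \<odot>\<^bsub>M\<^esub> u = a \<odot>\<^bsub>M\<^esub> u \<oplus>\<^bsub>M\<^esub> b \<odot>\<^bsub>M\<^esub> u"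
    and smult_r_distr:
      "\<lbrakk>a \<in> carrier R; u \<in> carrier M; v \<in> carrier M\<rbrakk> \<Longrightarrow>
       a \<odot>\<^bsub>M\<^esub> (u \<oplus>\<^bsub>M\<^esub> v) = a \<odot>\<^bsub>M\<^esub> u \<oplus>\<^bsub>M\<^esub> a \<odot>\<^bsub>M\<^esub> v"
    and smult_assoc1:
      "\<lbrakk>a \<in> carrier R; b \<in> carrier R; u \<in> carrier M\<rbrakk> \<Longrightarrow>
       (a \<otimes>\<^bsub>R\<^esub> b) \<odot>\<^bsub>M\<^esub> u = a \<odot>\<^bsub>M\<^esub> (b \<odot>\<^bsub>M\<^esub> u)"
    and smult_one [simp]:
      "u \<in> carrier M \<Longrightarrow> \<one>\<^bsub>R\<^esub> \<odot>\<^bsub>M\<^esub> u = u"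

definition simple_module ::
    "('r, 'x) ring_scheme \<Rightarrow> ('r, 'm, 'y) module_scheme \<Rightarrow> bool" where
  "simple_module R M \<longleftrightarrow> left_module R M \<and> carrier M \<noteq> {\<zero>\<^bsub>M\<^esub>} \<and>
     (\<forall>N. submodule N R M \<longrightarrow> N = {\<zero>\<^bsub>M\<^esub>} \<or> N = carrier M)"

definition module_isomorphic ::
    "('r, 'x) ring_scheme \<Rightarrow> ('r, 'm, 'y) module_scheme \<Rightarrow> ('r, 'n, 'z) module_scheme \<Rightarrow> bool" where
  "module_isomorphic R M N \<longleftrightarrow>
     (\<exists>f. bij_betw f (carrier M) (carrier N) \<and>
          (\<forall>u\<in>carrier M. \<forall>v\<in>carrier M. f (u \<oplus>\<^bsub>M\<^esub> v) = f u \<oplus>\<^bsub>N\<^esub> f v) \<and>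
          (\<forall>a\<in>carrier R. \<forall>u\<in>carrier M. f (a \<odot>\<^bsub>M\<^esub> u) = a \<odot>\<^bsub>N\<^esub> f u))"

definition cyclic_submodule ::
    "('r, 'x) ring_scheme \<Rightarrow> ('r, 'm, 'y) module_scheme \<Rightarrow> 'm \<Rightarrow> 'm set" where
  "cyclic_submodule R M u = {a \<odot>\<^bsub>M\<^esub> u | a. a \<in> carrier R}"

text \<open>The analogue of \<^const>\<open>FactRing\<close>.\<close>

definition quotient_module ::
    "('r, 'm, 'y) module_scheme \<Rightarrow> 'm set \<Rightarrow> ('r, 'm set) module" where
  "quotient_module M N =
     \<lparr>carrier = a_rcosets\<^bsub>M\<^esub> N, monoid.mult = undefined, one = undefined, zero = N, add = set_add M,
      module.smult = (\<lambda>a A. \<Union>u\<in>A. N +>\<^bsub>M\<^esub> (a \<odot>\<^bsub>M\<^esub> u))\<rparr>"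

lemma (in left_module) left_module_quotient:
  assumes "submodule N R M"
  shows "left_module R (quotient_module M N)"
    and quotient_module_smult: "\<And>a u. \<lbrakk>a \<in> carrier R; u \<in> carrier M\<rbrakk> \<Longrightarrow>
           a \<odot>\<^bsub>quotient_module M N\<^esub> (N +>\<^bsub>M\<^esub> u) = N +>\<^bsub>M\<^esub> (a \<odot>\<^bsub>M\<^esub> u)"
proof -
  interpret N: submodule N R M by fact
  interpret N: abelian_subgroup N M
    by (intro abelian_subgroupI3 additive_subgroup.intro N.subgroup_axioms M.abelian_group_axioms)
  have smult: "a \<odot>\<^bsub>quotient_module M N\<^esub> (N +>\<^bsub>M\<^esub> u) = N +>\<^bsub>M\<^esub> (a \<odot>\<^bsub>M\<^esub> u)"
    if a: "a \<in> carrier R" and u: "u \<in> carrier M" for a u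
  proof -
    have "N +>\<^bsub>M\<^esub> (a \<odot>\<^bsub>M\<^esub> w) = N +>\<^bsub>M\<^esub> (a \<odot>\<^bsub>M\<^esub> u)" if w: "w \<in> N +>\<^bsub>M\<^esub> u" for w
    proof -
      obtain m where m: "m \<in> N" "w = m \<oplus>\<^bsub>M\<^esub> u"
        using w by (auto simp: a_r_coset_def')
      have "a \<odot>\<^bsub>M\<^esub> w = a \<odot>\<^bsub>M\<^esub> m \<oplus>\<^bsub>M\<^esub> a \<odot>\<^bsub>M\<^esub> u"
        using m a u by (simp add: smult_r_distr N.a_Hcarr)
      moreover have "a \<odot>\<^bsub>M\<^esub> m \<in> N"
        using m a by simp
      ultimately have "a \<odot>\<^bsub>M\<^esub> w \<in> N +>\<^bsub>M\<^esub> (a \<odot>\<^bsub>M\<^esub> u)"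
        by (auto simp: a_r_coset_def')
      then show ?thesis
        by (rule M.a_repr_independence[symmetric, OF _ smult_closed[OF a u] N.a_subgroup])
    qed
    moreover have "u \<in> N +>\<^bsub>M\<^esub> u"
      using u by (rule N.a_rcos_self)
    ultimately have "(\<Union>w\<in>N +>\<^bsub>M\<^esub> u. N +>\<^bsub>M\<^esub> (a \<odot>\<^bsub>M\<^esub> w)) = N +>\<^bsub>M\<^esub> (a \<odot>\<^bsub>M\<^esub> u)"
      by blast
    then show ?thesis
      by (simp add: quotient_module_def)
  qed
  then show "\<And>a u. \<lbrakk>a \<in> carrier R; u \<in> carrier M\<rbrakk> \<Longrightarrow>
      a \<odot>\<^bsub>quotient_module M N\<^esub> (N +>\<^bsub>M\<^esub> u) = N +>\<^bsub>M\<^esub> (a \<odot>\<^bsub>M\<^esub> u)" .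
  have carr: "carrier (quotient_module M N) = {N +>\<^bsub>M\<^esub> u | u. u \<in> carrier M}"
    by (auto simp: quotient_module_def A_RCOSETS_def' a_r_coset_def')
  have add: "(N +>\<^bsub>M\<^esub> u) \<oplus>\<^bsub>quotient_module M N\<^esub> (N +>\<^bsub>M\<^esub> v) = N +>\<^bsub>M\<^esub> (u \<oplus>\<^bsub>M\<^esub> v)"
    if "u \<in> carrier M" "v \<in> carrier M" for u v
    using N.a_rcos_sum[OF that] by (simp add: quotient_module_def)
  have "abelian_group (quotient_module M N)"
  proof -
    interpret F: comm_group "A_FactGroup M N"
      by (rule N.a_factorgroup_is_comm_group)
    have eqs: "carrier (A_FactGroup M N) = carrier (quotient_module M N)"
      "\<one>\<^bsub>A_FactGroup M N\<^esub> = \<zero>\<^bsub>quotient_module M N\<^esub>"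
      "(\<otimes>\<^bsub>A_FactGroup M N\<^esub>) = (\<oplus>\<^bsub>quotient_module M N\<^esub>)"
      by (simp_all add: quotient_module_def A_FactGroup_def')
    show ?thesis
      by (rule abelian_groupI)
         (use F.m_closed F.m_assoc F.m_comm F.l_one F.one_closed F.l_inv_ex in
           \<open>simp_all add: eqs\<close>)
  qed
  then show "left_module R (quotient_module M N)"
  proof (intro left_module.intro R.ring_axioms left_module_axioms.intro)
    fix a A assume a: "a \<in> carrier R" and "A \<in> carrier (quotient_module M N)"
    then obtain u where u: "u \<in> carrier M" "A = N +>\<^bsub>M\<^esub> u"
      by (auto simp: carr)
    show "a \<odot>\<^bsub>quotient_module M N\<^esub> A \<in> carrier (quotient_module M N)"
      using a u unfolding u(2) smult[OF a u(1)] carr by blast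
    fix B assume "B \<in> carrier (quotient_module M N)"
    then obtain v where v: "v \<in> carrier M" "B = N +>\<^bsub>M\<^esub> v"
      by (auto simp: carr)
    show "a \<odot>\<^bsub>quotient_module M N\<^esub> (A \<oplus>\<^bsub>quotient_module M N\<^esub> B) =
          a \<odot>\<^bsub>quotient_module M N\<^esub> A \<oplus>\<^bsub>quotient_module M N\<^esub> a \<odot>\<^bsub>quotient_module M N\<^esub> B"
      using a u v by (simp add: add smult smult_r_distr)
  next
    fix a b A assume a: "a \<in> carrier R" "b \<in> carrier R" and "A \<in> carrier (quotient_module M N)"
    then obtain u where u: "u \<in> carrier M" "A = N +>\<^bsub>M\<^esub> u"
      by (auto simp: carr)
    show "(a \<oplus>\<^bsub>R\<^esub> b) \<odot>\<^bsub>quotient_module M N\<^esub> A =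
          a \<odot>\<^bsub>quotient_module M N\<^esub> A \<oplus>\<^bsub>quotient_module M N\<^esub> b \<odot>\<^bsub>quotient_module M N\<^esub> A"
      using a u by (simp add: add smult smult_l_distr)
    show "(a \<otimes>\<^bsub>R\<^esub> b) \<odot>\<^bsub>quotient_module M N\<^esub> A =
          a \<odot>\<^bsub>quotient_module M N\<^esub> (b \<odot>\<^bsub>quotient_module M N\<^esub> A)"
      using a u by (simp add: smult smult_assoc1)
  next
    fix A assume "A \<in> carrier (quotient_module M N)"
    then obtain u where u: "u \<in> carrier M" "A = N +>\<^bsub>M\<^esub> u"
      by (auto simp: carr)
    then show "\<one>\<^bsub>R\<^esub> \<odot>\<^bsub>quotient_module M N\<^esub> A = A"
      by (simp add: smult)
  qed
qed

lemma (in left_module) submodule_cyclic: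
  assumes u: "u \<in> carrier M"
  shows "submodule (cyclic_submodule R M u) R M"
proof (intro submodule.intro submodule_axioms.intro)
  have minus: "\<ominus>\<^bsub>M\<^esub> (a \<odot>\<^bsub>M\<^esub> u) = (\<ominus>\<^bsub>R\<^esub> a) \<odot>\<^bsub>M\<^esub> u" if a: "a \<in> carrier R" for a
  proof -
    have "\<zero>\<^bsub>R\<^esub> \<odot>\<^bsub>M\<^esub> u \<oplus>\<^bsub>M\<^esub> \<zero>\<^bsub>R\<^esub> \<odot>\<^bsub>M\<^esub> u = \<zero>\<^bsub>R\<^esub> \<odot>\<^bsub>M\<^esub> u"
      using smult_l_distr[of "\<zero>\<^bsub>R\<^esub>" "\<zero>\<^bsub>R\<^esub>" u] u by simp
    then have "\<zero>\<^bsub>R\<^esub> \<odot>\<^bsub>M\<^esub> u = \<zero>\<^bsub>M\<^esub>"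
      using u M.add.l_cancel_one'[of "\<zero>\<^bsub>R\<^esub> \<odot>\<^bsub>M\<^esub> u" "\<zero>\<^bsub>R\<^esub> \<odot>\<^bsub>M\<^esub> u"] by (metis R.zero_closed smult_closed M.add.l_cancel_one)
    then have "(\<ominus>\<^bsub>R\<^esub> a) \<odot>\<^bsub>M\<^esub> u \<oplus>\<^bsub>M\<^esub> a \<odot>\<^bsub>M\<^esub> u = \<zero>\<^bsub>M\<^esub>"
      using smult_l_distr[of "\<ominus>\<^bsub>R\<^esub> a" a u] a u by (simp add: R.l_neg)
    then show ?thesis
      using a u by (intro M.minus_equality) auto
  qed
  show "subgroup (cyclic_submodule R M u) (add_monoid M)"
  proof (rule group.subgroupI[OF M.a_group])
    fix v w assume "v \<in> cyclic_submodule R M u" "w \<in> cyclic_submodule R M u"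
    then show "v \<otimes>\<^bsub>add_monoid M\<^esub> w \<in> cyclic_submodule R M u"
      using u by (auto simp: cyclic_submodule_def smult_l_distr[symmetric])
  next
    fix v assume "v \<in> cyclic_submodule R M u"
    then show "inv\<^bsub>add_monoid M\<^esub> v \<in> cyclic_submodule R M u"
      using minus by (auto simp: cyclic_submodule_def a_inv_def[symmetric])
  qed (use u in \<open>auto simp: cyclic_submodule_def\<close>)
  show "a \<odot>\<^bsub>M\<^esub> v \<in> cyclic_submodule R M u"
    if "a \<in> carrier R" "v \<in> cyclic_submodule R M u" for a v
    using that u smult_assoc1[symmetric] by (auto simp: cyclic_submodule_def)
qed

text \<open>
  A module over a \<open>K\<close>-algebra \<open>R\<close> is a vector space over \<open>K\<close> through the structure map
  \<open>\<iota> : K \<rightarrow> R\<close> of the algebra.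
\<close>

definition finite_dim_module ::
    "('k \<Rightarrow> 'r) \<Rightarrow> ('r, 'm, 'y) module_scheme \<Rightarrow> bool" where
  "finite_dim_module \<iota> M \<longleftrightarrow>
     (\<exists>B. finite B \<and> B \<subseteq> carrier M \<and>
        (\<forall>u\<in>carrier M. \<exists>f. u = (\<Oplus>\<^bsub>M\<^esub>v\<in>B. \<iota> (f v) \<odot>\<^bsub>M\<^esub> v)))"

definition torsion_module ::
    "('r, 'x) ring_scheme \<Rightarrow> 'r \<Rightarrow> ('r, 'm, 'y) module_scheme \<Rightarrow> bool" where
  "torsion_module R t M \<longleftrightarrow>
     (\<forall>u\<in>carrier M. \<exists>k::nat. k \<ge> 1 \<and> (t [^]\<^bsub>R\<^esub> k) \<odot>\<^bsub>M\<^esub> u = \<zero>\<^bsub>M\<^esub>)"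


section \<open>Linear algebra on finitely supported functions\<close>

definition scale :: "'k::comm_ring_1 \<Rightarrow> ('a \<Rightarrow>\<^sub>0 'k) \<Rightarrow> ('a \<Rightarrow>\<^sub>0 'k)" where
  "scale r = Poly_Mapping.map ((*) r)"

definition lin_ext :: "('a \<Rightarrow> ('b \<Rightarrow>\<^sub>0 'k)) \<Rightarrow> ('a \<Rightarrow>\<^sub>0 'k) \<Rightarrow> ('b \<Rightarrow>\<^sub>0 'k::comm_ring_1)" where
  "lin_ext f u = (\<Sum>a\<in>Poly_Mapping.keys u. scale (Poly_Mapping.lookup u a) (f a))"

lemma lookup_scale [simp]: "Poly_Mapping.lookup (scale r u) a = r * Poly_Mapping.lookup u a"
  by (auto simp: scale_def Poly_Mapping.map.rep_eq when_def)

lemma scale_simps [simp]: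
  "scale r (u + v) = scale r u + scale r v"
  "scale r (u - v) = scale r u - scale r v"
  "scale (r + s) u = scale r u + scale s u"
  "scale (r - s) u = scale r u - scale s u"
  "scale r (scale s u) = scale (r * s) u"
  "scale r 0 = 0" "scale 0 u = 0" "scale 1 u = u"
  "scale r (Poly_Mapping.single a s) = Poly_Mapping.single a (r * s)"
  by (rule poly_mapping_eqI; simp add: lookup_add lookup_minus algebra_simps lookup_single when_def)+

lemma scale_sum: "scale r (sum f A) = (\<Sum>a\<in>A. scale r (f a))"
  by (induction A rule: infinite_finite_induct) auto

lemma lin_ext_superset:
  assumes "finite A" "Poly_Mapping.keys u \<subseteq> A"
  shows "lin_ext f u = (\<Sum>a\<in>A. scale (Poly_Mapping.lookup u a) (f a))"
  unfolding lin_ext_def using assms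
  by (intro sum.mono_neutral_left) (auto simp: in_keys_iff)

lemma lin_ext_zero [simp]: "lin_ext f 0 = 0"
  by (simp add: lin_ext_def)

lemma lin_ext_single [simp]: "lin_ext f (Poly_Mapping.single a r) = scale r (f a)"
  by (cases "r = 0") (simp_all add: lin_ext_def)

lemma lin_ext_add: "lin_ext f (u + v) = lin_ext f u + lin_ext f v"
proof -
  let ?A = "Poly_Mapping.keys u \<union> Poly_Mapping.keys v"
  show ?thesis
    by (subst (1 2 3) lin_ext_superset[of ?A])
       (use keys_add[of u v] in \<open>auto simp: lookup_add sum.distrib\<close>)
qed

lemma lin_ext_scale: "lin_ext f (scale r u) = scale r (lin_ext f u)"
  by (subst (1 2) lin_ext_superset[of "Poly_Mapping.keys u"])
     (auto simp: scale_sum in_keys_iff intro!: sum.cong)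

lemma lin_ext_diff: "lin_ext f (u - v) = lin_ext f u - lin_ext f v"
  using lin_ext_add[of f "u - v" v] by simp

lemma lin_ext_sum: "lin_ext f (sum u A) = (\<Sum>a\<in>A. lin_ext f (u a))"
  by (induction A rule: infinite_finite_induct) (auto simp: lin_ext_add)

lemma poly_mapping_sum_single:
  "u = (\<Sum>a\<in>Poly_Mapping.keys u. Poly_Mapping.single a (Poly_Mapping.lookup u a))"
  by (rule poly_mapping_eqI)
     (auto simp: lookup_sum lookup_single when_def in_keys_iff sum.delta)

lemma additive_eqI:
  fixes f :: "('a \<Rightarrow>\<^sub>0 'k::comm_ring_1) \<Rightarrow> 'b::cancel_comm_monoid_add"
  assumes "\<And>u v. f (u + v) = f u + f v" "\<And>u v. h (u + v) = h u + h v"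
    and "\<And>a r. f (Poly_Mapping.single a r) = h (Poly_Mapping.single a r)"
  shows "f u = h u"
proof -
  have 0: "f 0 = 0" "h 0 = 0"
    using assms(1,2)[of 0 0] by auto
  have "f (sum w A) = (\<Sum>a\<in>A. f (w a))" "h (sum w A) = (\<Sum>a\<in>A. h (w a))"
    for w and A :: "'a set"
    by (induction A rule: infinite_finite_induct) (auto simp: 0 assms)
  then show ?thesis
    by (subst (1 2) poly_mapping_sum_single) (simp add: assms(3))
qed


section \<open>Characters and the group algebra\<close>

text \<open>
  The abelian group \<open>G\<close> is a type of class \<^class>\<open>ab_group_add\<close>, so it is written additively:
  \<open>bc \<noteq> 1\<close> reads \<open>b + c \<noteq> 0\<close> and \<open>c\<^sup>-\<^sup>1\<close> reads \<open>- c\<close>. The group algebra of \<open>G\<close> over \<open>K\<close> is then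
  the type \<open>'g \<Rightarrow>\<^sub>0 'k\<close> with its convolution product, and the group element \<open>g\<close> is
  \<open>Poly_Mapping.single g 1\<close>.
\<close>

definition is_character :: "('g::ab_group_add \<Rightarrow> 'k::field) \<Rightarrow> bool" where
  "is_character \<rho> \<longleftrightarrow> (\<forall>g. \<rho> g \<noteq> 0) \<and> (\<forall>g h. \<rho> (g + h) = \<rho> g * \<rho> h)"

definition character_group :: "('g::ab_group_add \<Rightarrow> 'k::field) monoid" where
  "character_group =
     \<lparr>carrier = {\<rho>. is_character \<rho>}, monoid.mult = (\<lambda>\<rho> \<tau> g. \<rho> g * \<tau> g), one = (\<lambda>_. 1)\<rparr>"

lemma is_character_zero [simp]: "is_character \<rho> \<Longrightarrow> \<rho> 0 = 1"
  unfolding is_character_def by (metis add.right_neutral mult_cancel_left2)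

lemma is_character_minus: "is_character \<rho> \<Longrightarrow> \<rho> (- g) = inverse (\<rho> g)"
  using is_character_zero[of \<rho>]
  by (metis ab_left_minus inverse_unique is_character_def mult.commute)

lemma character_group_group: "group (character_group :: ('g::ab_group_add \<Rightarrow> 'k::field) monoid)"
proof (rule groupI)
  fix \<rho> :: "'g \<Rightarrow> 'k" assume "\<rho> \<in> carrier character_group"
  then show "\<exists>\<tau>\<in>carrier character_group. \<tau> \<otimes>\<^bsub>character_group\<^esub> \<rho> = \<one>\<^bsub>character_group\<^esub>"
    by (intro bexI[of _ "\<lambda>g. inverse (\<rho> g)"])
       (auto simp: character_group_def is_character_def)
qed (auto simp: character_group_def is_character_def mult_ac)

definition char_ext :: "('g \<Rightarrow> 'k::field) \<Rightarrow> ('g \<Rightarrow>\<^sub>0 'k) \<Rightarrow> 'k" where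
  "char_ext \<rho> u = (\<Sum>g\<in>Poly_Mapping.keys u. Poly_Mapping.lookup u g * \<rho> g)"

lemma char_ext_single [simp]: "char_ext \<rho> (Poly_Mapping.single g r) = r * \<rho> g"
  by (cases "r = 0") (auto simp: char_ext_def)

lemma char_ext_add: "char_ext \<rho> (u + v) = char_ext \<rho> u + char_ext \<rho> v"
proof -
  let ?A = "Poly_Mapping.keys u \<union> Poly_Mapping.keys v"
  have "char_ext \<rho> w = (\<Sum>g\<in>?A. Poly_Mapping.lookup w g * \<rho> g)"
    if "Poly_Mapping.keys w \<subseteq> ?A" for w
    unfolding char_ext_def using that
    by (intro sum.mono_neutral_left) (auto simp: in_keys_iff)
  then show ?thesis
    using keys_add[of u v] by (simp add: lookup_add algebra_simps sum.distrib)
qed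

lemma char_ext_diff: "char_ext \<rho> (u - v) = char_ext \<rho> u - char_ext \<rho> v"
  using char_ext_add[of \<rho> "u - v" v] by (simp add: algebra_simps)

definition sigma :: "('g \<Rightarrow> 'k::field) \<Rightarrow> ('g \<Rightarrow>\<^sub>0 'k) \<Rightarrow> ('g \<Rightarrow>\<^sub>0 'k)" where
  "sigma \<chi> = lin_ext (\<lambda>g. scale (\<chi> g) (Poly_Mapping.single g 1))"

lemma lookup_sigma: "Poly_Mapping.lookup (sigma \<chi> u) g = \<chi> g * Poly_Mapping.lookup u g"
  by (rule additive_eqI[where f = "\<lambda>u. Poly_Mapping.lookup (sigma \<chi> u) g"])
     (auto simp: sigma_def lin_ext_add lookup_add algebra_simps lookup_single when_def)

lemma inv_sigma:
  assumes "is_character \<chi>"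
  shows "inv_into UNIV (sigma \<chi>) = sigma (\<lambda>g. inverse (\<chi> g))"
  by (rule inv_unique_comp; rule ext; rule poly_mapping_eqI)
     (use assms in \<open>auto simp: lookup_sigma is_character_def\<close>)

lemma inv_sigma_single:
  assumes "is_character \<chi>"
  shows "(inv_into UNIV (sigma \<chi>) ^^ i) (Poly_Mapping.single g r) =
         Poly_Mapping.single g (inverse (\<chi> g) ^ i * r)"
  unfolding inv_sigma[OF assms]
  by (induction i) (auto simp: sigma_def mult_ac)

definition sigma_bracket :: "('g \<Rightarrow> 'k::field) \<Rightarrow> ('g \<Rightarrow>\<^sub>0 'k) \<Rightarrow> nat \<Rightarrow> ('g \<Rightarrow>\<^sub>0 'k)" where
  "sigma_bracket \<chi> u i = (\<Sum>k<i. (inv_into UNIV (sigma \<chi>) ^^ k) u)"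

definition e_elem :: "'g::ab_group_add \<Rightarrow> 'g \<Rightarrow> ('g \<Rightarrow>\<^sub>0 'k::field)" where
  "e_elem b c = Poly_Mapping.single (- c) 1 - Poly_Mapping.single b 1"


section \<open>The algebra\<close>

text \<open>
  The free monoid gets its own type, written additively, because the product on \<^type>\<open>poly_mapping\<close>
  is the convolution along \<open>+\<close> and \<^type>\<open>list\<close> has no such instance. The free algebra is the
  monoid algebra of the free monoid.
\<close>

datatype 'a word = Word (letters: "'a list")

instantiation word :: (type) monoid_add
begin
definition "0 = Word []"
definition "v + w = Word (letters v @ letters w)"
instance by standard (auto simp: zero_word_def plus_word_def)
end

datatype 'g generator = Ggen 'g | Xgen | Ygen

type_synonym ('g, 'k) free_algebra = "'g generator word \<Rightarrow>\<^sub>0 'k"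

definition gen :: "'g generator \<Rightarrow> ('g, 'k::field) free_algebra" where
  "gen z = Poly_Mapping.single (Word [z]) 1"

definition const :: "'k::field \<Rightarrow> ('g, 'k) free_algebra" where
  "const r = Poly_Mapping.single 0 r"

text \<open>The relations of \<open>G\<close> are its whole multiplication table.\<close>

definition relators ::
    "('g::ab_group_add \<Rightarrow> 'k::field) \<Rightarrow> 'g \<Rightarrow> 'g \<Rightarrow> ('g, 'k) free_algebra set" where
  "relators \<chi> b c =
     {gen (Ggen 0) - 1} \<union>
     {gen (Ggen g) * gen (Ggen h) - gen (Ggen (g + h)) | g h. True} \<union>
     {gen Xgen * gen (Ggen g) - const (\<chi> g) * gen (Ggen g) * gen Xgen | g. True} \<union>
     {gen Ygen * gen (Ggen g) - const (inverse (\<chi> g)) * gen (Ggen g) * gen Ygen | g. True} \<union>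
     {gen Ygen * gen Xgen - (gen Xgen * gen Ygen + lin_ext (\<lambda>g. gen (Ggen g)) (e_elem b c))}"

definition rel_ideal ::
    "('g::ab_group_add \<Rightarrow> 'k::field) \<Rightarrow> 'g \<Rightarrow> 'g \<Rightarrow> ('g, 'k) free_algebra set" where
  "rel_ideal \<chi> b c = Idl\<^bsub>ring_of_type_algebra\<^esub> (relators \<chi> b c)"

definition H_alg ::
    "('g::ab_group_add \<Rightarrow> 'k::field) \<Rightarrow> 'g \<Rightarrow> 'g \<Rightarrow> ('g, 'k) free_algebra set ring" where
  "H_alg \<chi> b c = ring_of_type_algebra Quot rel_ideal \<chi> b c"

definition H_class ::
    "('g::ab_group_add \<Rightarrow> 'k::field) \<Rightarrow> 'g \<Rightarrow> 'g \<Rightarrow> ('g, 'k) free_algebra \<Rightarrow>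
     ('g, 'k) free_algebra set" where
  "H_class \<chi> b c a = rel_ideal \<chi> b c +>\<^bsub>ring_of_type_algebra\<^esub> a"

lemma ring_of_type_algebra_simps [simp]:
  "carrier ring_of_type_algebra = UNIV" "a \<otimes>\<^bsub>ring_of_type_algebra\<^esub> b = a * b"
  "a \<oplus>\<^bsub>ring_of_type_algebra\<^esub> b = a + b"
  "\<one>\<^bsub>ring_of_type_algebra\<^esub> = 1" "\<zero>\<^bsub>ring_of_type_algebra\<^esub> = 0"
  by (simp_all add: ring_of_type_algebra_def)

lemma ring_ring_of_type_algebra: "ring (ring_of_type_algebra :: 'a::ring_1 ring)"
proof (rule ringI)
  show "abelian_group (ring_of_type_algebra :: 'a ring)"
  proof (rule abelian_groupI)
    fix x :: 'a
    show "\<exists>y\<in>carrier ring_of_type_algebra.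
            y \<oplus>\<^bsub>ring_of_type_algebra\<^esub> x = \<zero>\<^bsub>ring_of_type_algebra\<^esub>"
      by (intro bexI[of _ "- x"]) auto
  qed (auto simp: algebra_simps)
  show "Group.monoid (ring_of_type_algebra :: 'a ring)"
    by (rule monoidI) (auto simp: algebra_simps)
qed (auto simp: algebra_simps)

lemma rel_ideal_ideal: "ideal (rel_ideal \<chi> b c) ring_of_type_algebra"
  unfolding rel_ideal_def by (rule ring.genideal_ideal[OF ring_ring_of_type_algebra]) simp

lemma H_alg_ring: "ring (H_alg \<chi> b c)"
  unfolding H_alg_def by (rule ideal.quotient_is_ring[OF rel_ideal_ideal])

lemma H_class_eq: "H_class \<chi> b c a = {r + a | r. r \<in> rel_ideal \<chi> b c}"
  by (auto simp: H_class_def a_r_coset_def r_coset_def)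

lemma H_class_self: "a \<in> H_class \<chi> b c a"
  using additive_subgroup.zero_closed[OF ideal.axioms(1)[OF rel_ideal_ideal, of \<chi> b c]]
  by (force simp: H_class_eq)

lemma H_alg_simps:
  "carrier (H_alg \<chi> b c) = range (H_class \<chi> b c)"
  "\<one>\<^bsub>H_alg \<chi> b c\<^esub> = H_class \<chi> b c 1"
  "H_class \<chi> b c p \<otimes>\<^bsub>H_alg \<chi> b c\<^esub> H_class \<chi> b c q = H_class \<chi> b c (p * q)"
  "H_class \<chi> b c p \<oplus>\<^bsub>H_alg \<chi> b c\<^esub> H_class \<chi> b c q = H_class \<chi> b c (p + q)"
proof -
  interpret ideal "rel_ideal \<chi> b c" ring_of_type_algebra
    by (rule rel_ideal_ideal)
  show "carrier (H_alg \<chi> b c) = range (H_class \<chi> b c)"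
    by (auto simp: H_alg_def H_class_def FactRing_def A_RCOSETS_def' a_r_coset_def')
  show "\<one>\<^bsub>H_alg \<chi> b c\<^esub> = H_class \<chi> b c 1"
    by (simp add: H_alg_def H_class_def FactRing_def)
  show "H_class \<chi> b c p \<otimes>\<^bsub>H_alg \<chi> b c\<^esub> H_class \<chi> b c q = H_class \<chi> b c (p * q)"
    by (simp add: H_alg_def H_class_def FactRing_def rcoset_mult_add)
  show "H_class \<chi> b c p \<oplus>\<^bsub>H_alg \<chi> b c\<^esub> H_class \<chi> b c q = H_class \<chi> b c (p + q)"
    by (simp add: H_alg_def H_class_def FactRing_def a_rcos_sum)
qed


section \<open>The modules \<open>V(\<rho>)\<close> and their quotients\<close>

text \<open>The basis vector \<open>v\<^sub>i\<close> is \<open>Poly_Mapping.single i 1 :: nat \<Rightarrow>\<^sub>0 'k\<close>.\<close>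

fun V_gen_basis ::
    "('g::ab_group_add \<Rightarrow> 'k::field) \<Rightarrow> 'g \<Rightarrow> 'g \<Rightarrow> ('g \<Rightarrow> 'k) \<Rightarrow> 'g generator \<Rightarrow> nat \<Rightarrow>
     (nat \<Rightarrow>\<^sub>0 'k)" where
  "V_gen_basis \<chi> b c \<rho> (Ggen g) i =
     Poly_Mapping.single i (char_ext \<rho> ((inv_into UNIV (sigma \<chi>) ^^ i) (Poly_Mapping.single g 1)))"
| "V_gen_basis \<chi> b c \<rho> Xgen i = Poly_Mapping.single (i + 1) 1"
| "V_gen_basis \<chi> b c \<rho> Ygen i =
     (if i = 0 then 0
      else Poly_Mapping.single (i - 1) (char_ext \<rho> (sigma_bracket \<chi> (e_elem b c) i)))"

definition V_act ::
    "('g::ab_group_add \<Rightarrow> 'k::field) \<Rightarrow> 'g \<Rightarrow> 'g \<Rightarrow> ('g \<Rightarrow> 'k) \<Rightarrow> ('g, 'k) free_algebra \<Rightarrow>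
     (nat \<Rightarrow>\<^sub>0 'k) \<Rightarrow> (nat \<Rightarrow>\<^sub>0 'k)" where
  "V_act \<chi> b c \<rho> a v =
     lin_ext (\<lambda>w. foldr (\<lambda>z. lin_ext (V_gen_basis \<chi> b c \<rho> z)) (letters w) v) a"

lemma V_act_add: "V_act \<chi> b c \<rho> a (u + v) = V_act \<chi> b c \<rho> a u + V_act \<chi> b c \<rho> a v"
proof -
  have "foldr (\<lambda>z. lin_ext (V_gen_basis \<chi> b c \<rho> z)) zs (u + v) =
        foldr (\<lambda>z. lin_ext (V_gen_basis \<chi> b c \<rho> z)) zs u +
        foldr (\<lambda>z. lin_ext (V_gen_basis \<chi> b c \<rho> z)) zs v" for zs
    by (induction zs) (auto simp: lin_ext_add)
  then show ?thesis
    by (simp add: V_act_def lin_ext_def sum.distrib)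
qed

lemma V_act_scale: "V_act \<chi> b c \<rho> a (scale r v) = scale r (V_act \<chi> b c \<rho> a v)"
proof -
  have "foldr (\<lambda>z. lin_ext (V_gen_basis \<chi> b c \<rho> z)) zs (scale r v) =
        scale r (foldr (\<lambda>z. lin_ext (V_gen_basis \<chi> b c \<rho> z)) zs v)" for zs
    by (induction zs) (auto simp: lin_ext_scale)
  then show ?thesis
    by (simp add: V_act_def lin_ext_def scale_sum mult_ac)
qed

lemma V_act_add_left: "V_act \<chi> b c \<rho> (p + q) v = V_act \<chi> b c \<rho> p v + V_act \<chi> b c \<rho> q v"
  by (simp add: V_act_def lin_ext_add)

lemma V_act_diff_left: "V_act \<chi> b c \<rho> (p - q) v = V_act \<chi> b c \<rho> p v - V_act \<chi> b c \<rho> q v"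
  by (simp add: V_act_def lin_ext_diff)

lemma V_act_const [simp]: "V_act \<chi> b c \<rho> (const r) v = scale r v"
  by (simp add: V_act_def const_def zero_word_def)

lemma V_act_one [simp]: "V_act \<chi> b c \<rho> 1 v = v"
  using V_act_const[of \<chi> b c \<rho> 1 v] by (simp add: const_def)

lemma V_act_zero [simp]: "V_act \<chi> b c \<rho> a 0 = 0" "V_act \<chi> b c \<rho> 0 v = 0"
  using V_act_scale[of \<chi> b c \<rho> a 0 0] by (simp_all add: V_act_def)

lemma V_act_gen: "V_act \<chi> b c \<rho> (gen z) = lin_ext (V_gen_basis \<chi> b c \<rho> z)"
  by (simp add: V_act_def gen_def fun_eq_iff)

lemma V_act_mult: "V_act \<chi> b c \<rho> (p * q) v = V_act \<chi> b c \<rho> p (V_act \<chi> b c \<rho> q v)"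
proof (rule additive_eqI[where f = "\<lambda>p. V_act \<chi> b c \<rho> (p * q) v"])
  fix w :: "'b generator word" and r
  show "V_act \<chi> b c \<rho> (Poly_Mapping.single w r * q) v =
        V_act \<chi> b c \<rho> (Poly_Mapping.single w r) (V_act \<chi> b c \<rho> q v)"
  proof (rule additive_eqI[where f = "\<lambda>q. V_act \<chi> b c \<rho> (Poly_Mapping.single w r * q) v"])
    fix w' :: "'b generator word" and s
    have "V_act \<chi> b c \<rho> (Poly_Mapping.single w r) (V_act \<chi> b c \<rho> (Poly_Mapping.single w' s) v) =
          V_act \<chi> b c \<rho> (Poly_Mapping.single w r)
            (scale s (V_act \<chi> b c \<rho> (Poly_Mapping.single w' 1) v))"
      by (simp add: V_act_def)
    also have "\<dots> = V_act \<chi> b c \<rho> (Poly_Mapping.single w r * Poly_Mapping.single w' s) v"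
      unfolding V_act_scale by (simp add: V_act_def mult_single plus_word_def mult_ac)
    finally show "V_act \<chi> b c \<rho> (Poly_Mapping.single w r * Poly_Mapping.single w' s) v =
          V_act \<chi> b c \<rho> (Poly_Mapping.single w r) (V_act \<chi> b c \<rho> (Poly_Mapping.single w' s) v)"
      by simp
  qed (simp_all add: algebra_simps V_act_add V_act_add_left)
qed (simp_all add: algebra_simps V_act_add V_act_add_left)

lemma V_gen_basis_Ggen:
  assumes "is_character \<chi>"
  shows "V_gen_basis \<chi> b c \<rho> (Ggen g) i = Poly_Mapping.single i (inverse (\<chi> g) ^ i * \<rho> g)"
  by (simp add: inv_sigma_single[OF assms])

lemma sigma_bracket_Suc:
  "sigma_bracket \<chi> u (Suc i) = sigma_bracket \<chi> u i + (inv_into UNIV (sigma \<chi>) ^^ i) u"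
  by (simp add: sigma_bracket_def)

lemma V_act_relator:
  assumes "is_character \<chi>" "is_character \<rho>" "a \<in> relators \<chi> b c"
  shows "V_act \<chi> b c \<rho> a v = 0"
proof (rule additive_eqI[where f = "V_act \<chi> b c \<rho> a" and h = "\<lambda>_. 0"])
  fix i r
  have nz: "\<chi> g \<noteq> 0" for g
    using assms(1) by (simp add: is_character_def)
  have hom: "\<chi> (g + h) = \<chi> g * \<chi> h" "\<rho> (g + h) = \<rho> g * \<rho> h" for g h
    using assms(1,2) by (simp_all add: is_character_def)
  have inv_e: "(inv_into UNIV (sigma \<chi>) ^^ i) (e_elem b c) =
      Poly_Mapping.single (- c) (inverse (\<chi> (- c)) ^ i)
      - Poly_Mapping.single b (inverse (\<chi> b) ^ i)"
  proof -
    have "(inv_into UNIV (sigma \<chi>) ^^ i) (u - w) =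
          (inv_into UNIV (sigma \<chi>) ^^ i) u - (inv_into UNIV (sigma \<chi>) ^^ i) w" for u w
      unfolding inv_sigma[OF assms(1)] by (induction i) (auto simp: sigma_def lin_ext_diff)
    then show ?thesis
      by (simp add: e_elem_def inv_sigma_single[OF assms(1)])
  qed
  note simps = V_act_add_left V_act_diff_left V_act_mult V_act_gen
  note [simp del] = V_gen_basis.simps(1) lin_ext_single
  have G: "lin_ext (V_gen_basis \<chi> b c \<rho> (Ggen g)) (Poly_Mapping.single j s) =
      Poly_Mapping.single j (s * (inverse (\<chi> g) ^ j * \<rho> g))" for g j s
    by (simp add: V_gen_basis_Ggen[OF assms(1)] lin_ext_single)
  have E: "lin_ext (\<lambda>g. gen (Ggen g)) (e_elem b c) = gen (Ggen (- c)) - gen (Ggen b)"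
    by (simp add: e_elem_def lin_ext_diff lin_ext_single)
  define B where "B j = char_ext \<rho> (sigma_bracket \<chi> (e_elem b c) j)" for j
  have B_Suc: "B (Suc i) = B i + (inverse (\<chi> (- c)) ^ i * \<rho> (- c) - inverse (\<chi> b) ^ i * \<rho> b)"
    by (simp only: B_def sigma_bracket_Suc char_ext_add inv_e char_ext_diff char_ext_single)
  have X: "lin_ext (V_gen_basis \<chi> b c \<rho> Xgen) (Poly_Mapping.single j s) =
      Poly_Mapping.single (Suc j) s" for j s
    by (simp add: lin_ext_single)
  have Y: "lin_ext (V_gen_basis \<chi> b c \<rho> Ygen) (Poly_Mapping.single (Suc j) s) =
      Poly_Mapping.single j (s * B (Suc j))" for j s
    by (simp add: B_def lin_ext_single)
  have Y0: "lin_ext (V_gen_basis \<chi> b c \<rho> Ygen) (Poly_Mapping.single 0 s) = 0" for s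
    by (simp add: lin_ext_single)
  have XY: "lin_ext (V_gen_basis \<chi> b c \<rho> Xgen) (lin_ext (V_gen_basis \<chi> b c \<rho> Ygen)
      (Poly_Mapping.single i r)) = Poly_Mapping.single i (r * B i)"
    by (cases i) (simp_all add: B_def lin_ext_single sigma_bracket_def[of _ _ 0] char_ext_def[of _ 0])
  have YX: "V_act \<chi> b c \<rho> (gen Ygen * gen Xgen - (gen Xgen * gen Ygen + (gen (Ggen (- c)) -
      gen (Ggen b)))) (Poly_Mapping.single i r) = 0"
    unfolding simps XY G X Y B_Suc
    by (simp flip: single_add single_diff add: algebra_simps)
  show "V_act \<chi> b c \<rho> a (Poly_Mapping.single i r) = 0"
    using assms(3) unfolding relators_def
  proof (elim UnE CollectE exE conjE)
    assume "a \<in> {gen (Ggen 0) - 1}"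
    then show ?thesis
      by (simp add: simps G assms(1,2))
  next
    fix g h assume "a = gen (Ggen g) * gen (Ggen h) - gen (Ggen (g + h))"
    then show ?thesis
      by (simp add: simps G hom power_mult_distrib mult_ac)
  next
    fix g assume a: "a = gen Xgen * gen (Ggen g) - const (\<chi> g) * gen (Ggen g) * gen Xgen"
    have cancel: "r * (\<chi> g * (\<rho> g * (inverse (\<chi> g) * inverse (\<chi> g) ^ i))) =
        r * (\<rho> g * inverse (\<chi> g) ^ i)"
      using nz[of g] by (simp add: field_simps)
    show ?thesis
      by (simp add: a simps G X cancel mult_ac)
  next
    fix g assume "a = gen Ygen * gen (Ggen g) - const (inverse (\<chi> g)) * gen (Ggen g) * gen Ygen"
    then show ?thesis
      by (cases i) (simp_all add: simps G Y Y0 mult_ac)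
  next
    assume "a \<in> {gen Ygen * gen Xgen - (gen Xgen * gen Ygen +
      lin_ext (\<lambda>g. gen (Ggen g)) (e_elem b c))}"
    then show ?thesis
      using YX by (simp only: E singleton_iff)
  qed
qed (simp_all add: V_act_add)

lemma V_act_rel_ideal:
  assumes "is_character \<chi>" "is_character \<rho>" "a \<in> rel_ideal \<chi> b c"
  shows "V_act \<chi> b c \<rho> a v = 0"
proof -
  let ?I = "{a. \<forall>v. V_act \<chi> b c \<rho> a v = 0}"
  have minus: "V_act \<chi> b c \<rho> (- a) v = - V_act \<chi> b c \<rho> a v" for a v
    using V_act_diff_left[of \<chi> b c \<rho> 0 a v] by simp
  have "ideal ?I ring_of_type_algebra"
  proof (rule idealI[OF ring_ring_of_type_algebra])
    show "subgroup ?I (add_monoid ring_of_type_algebra)"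
    proof (rule group.subgroupI)
      show "group (add_monoid (ring_of_type_algebra :: ('a, 'b) free_algebra ring))"
        using ring_ring_of_type_algebra abelian_group.a_group ring.is_abelian_group by blast
      fix a assume a: "a \<in> ?I"
      have "inv\<^bsub>add_monoid ring_of_type_algebra\<^esub> a = - a"
        using abelian_group.minus_equality[OF ring.is_abelian_group[OF
            ring_ring_of_type_algebra[where 'a = "('a, 'b) free_algebra"]], of "- a" a]
        by (simp add: a_inv_def)
      then show "inv\<^bsub>add_monoid ring_of_type_algebra\<^esub> a \<in> ?I"
        using a minus by simp
    qed (auto simp: V_act_add_left intro: exI[of _ 0])
  qed (auto simp: V_act_mult)
  then have "rel_ideal \<chi> b c \<subseteq> ?I"
    unfolding rel_ideal_def using V_act_relator[OF assms(1,2)]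
    by (intro ring.genideal_minimal[OF ring_ring_of_type_algebra]) auto
  then show ?thesis
    using assms(3) by auto
qed

lemma V_act_coset:
  assumes "is_character \<chi>" "is_character \<rho>"
  shows "(\<lambda>a. V_act \<chi> b c \<rho> a v) ` H_class \<chi> b c p = {V_act \<chi> b c \<rho> p v}"
  using H_class_self[of p \<chi> b c]
  by (auto simp: H_class_eq V_act_add_left V_act_rel_ideal[OF assms])

text \<open>
  An element of the quotient algebra is a coset, all of whose members act in the same way
  by \<open>V_act_coset\<close>.
\<close>

definition V_mod ::
    "('g::ab_group_add \<Rightarrow> 'k::field) \<Rightarrow> 'g \<Rightarrow> 'g \<Rightarrow> ('g \<Rightarrow> 'k) \<Rightarrow>
     (('g, 'k) free_algebra set, nat \<Rightarrow>\<^sub>0 'k) module" where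
  "V_mod \<chi> b c \<rho> =
     \<lparr>carrier = UNIV, monoid.mult = undefined, one = undefined, zero = 0, add = (+),
      module.smult = (\<lambda>A v. the_elem ((\<lambda>a. V_act \<chi> b c \<rho> a v) ` A))\<rparr>"

lemma V_mod_smult:
  assumes "is_character \<chi>" "is_character \<rho>"
  shows "H_class \<chi> b c p \<odot>\<^bsub>V_mod \<chi> b c \<rho>\<^esub> v = V_act \<chi> b c \<rho> p v"
  by (simp add: V_mod_def V_act_coset[OF assms])

lemma V_mod_left_module:
  assumes "is_character \<chi>" "is_character \<rho>"
  shows "left_module (H_alg \<chi> b c) (V_mod \<chi> b c \<rho>)"
proof -
  have simps: "carrier (V_mod \<chi> b c \<rho>) = UNIV" "u \<oplus>\<^bsub>V_mod \<chi> b c \<rho>\<^esub> v = u + v"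
    "\<zero>\<^bsub>V_mod \<chi> b c \<rho>\<^esub> = 0" for u v
    by (simp_all add: V_mod_def)
  have "abelian_group (V_mod \<chi> b c \<rho>)"
  proof (rule abelian_groupI)
    fix v
    show "\<exists>u\<in>carrier (V_mod \<chi> b c \<rho>). u \<oplus>\<^bsub>V_mod \<chi> b c \<rho>\<^esub> v = \<zero>\<^bsub>V_mod \<chi> b c \<rho>\<^esub>"
      by (intro bexI[of _ "- v"]) (auto simp: simps)
  qed (auto simp: simps algebra_simps)
  then show ?thesis
    by (intro left_module.intro H_alg_ring left_module_axioms.intro)
       (auto simp: simps H_alg_simps V_mod_smult[OF assms] V_act_add V_act_add_left V_act_mult)
qed

text \<open>
  The number \<open>d\<close> of the definition of the quotient. If \<open>\<chi> b = \<chi> c \<noteq> 1\<close> there is such a \<open>d\<close> for every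
  \<open>\<rho>\<close> when \<open>\<chi>\<close> has finite order; if \<open>\<chi> b = \<chi> c = 1\<close>, then \<open>[e]\<^sub>i = i e\<close>, so \<open>d\<close> exists
  exactly if \<open>\<rho>(e) = 0\<close>, and otherwise the value is unspecified.
\<close>

definition V_dim :: "('g::ab_group_add \<Rightarrow> 'k::field) \<Rightarrow> 'g \<Rightarrow> 'g \<Rightarrow> ('g \<Rightarrow> 'k) \<Rightarrow> nat" where
  "V_dim \<chi> b c \<rho> = (LEAST d. d > 0 \<and> char_ext \<rho> (sigma_bracket \<chi> (e_elem b c) d) = 0)"

definition Vbar_mod ::
    "('g::ab_group_add \<Rightarrow> 'k::field) \<Rightarrow> 'g \<Rightarrow> 'g \<Rightarrow> ('g \<Rightarrow> 'k) \<Rightarrow>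
     (('g, 'k) free_algebra set, (nat \<Rightarrow>\<^sub>0 'k) set) module" where
  "Vbar_mod \<chi> b c \<rho> =
     quotient_module (V_mod \<chi> b c \<rho>)
       (cyclic_submodule (H_alg \<chi> b c) (V_mod \<chi> b c \<rho>)
         (Poly_Mapping.single (V_dim \<chi> b c \<rho>) 1))"

lemma Vbar_mod_left_module:
  assumes "is_character \<chi>" "is_character \<rho>"
  shows "left_module (H_alg \<chi> b c) (Vbar_mod \<chi> b c \<rho>)"
proof -
  interpret left_module "H_alg \<chi> b c" "V_mod \<chi> b c \<rho>"
    by (rule V_mod_left_module[OF assms])
  show ?thesis
    unfolding Vbar_mod_def by (intro left_module_quotient submodule_cyclic) (simp add: V_mod_def)
qed

end

theory Submission
  imports Defs
begin

text \<open>
  Let \<open>M\<close> be a finite dimensional simple module that is \<open>x\<close>- and \<open>y\<close>-torsion. By \<open>y\<close>-torsion the kernel of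
  \<open>y\<close> on \<open>M\<close> is not zero. It is stable under \<open>G\<close>, whose elements act by commuting operators, so over
  an algebraically closed field it contains a common eigenvector \<open>v\<close>, and the eigenvalues form a
  character \<open>\<rho>\<close> (\<open>exists_weight_vector\<close>). Eigenvalues come from an annihilating polynomial of a vector,
  which exists because \<open>M\<close> has finite dimension (\<open>exists_annihilating_poly\<close>); the generators of \<open>G\<close>
  are treated one after the other.

  The relations of \<open>H\<close> give \<open>y x\<^sup>i v = \<rho>([e]\<^sub>i) x\<^sup>i\<^sup>-\<^sup>1 v\<close>, so that \<open>v\<^sub>i \<mapsto> x\<^sup>i v\<close> is a homomorphism
  \<open>V(\<rho>) \<rightarrow> M\<close> (\<open>hom_V_act\<close>), which is onto because \<open>M\<close> is simple. Let \<open>x\<^sup>m v\<close> be the last nonzero vector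
  among the \<open>x\<^sup>i v\<close>. Nilpotency of \<open>x\<close> makes \<open>v, x v, \<dots>, x\<^sup>m v\<close> linearly independent, so the kernel is
  the span of the \<open>v\<^sub>i\<close> with \<open>i > m\<close> (\<open>hom_V_eq_0_iff\<close>). Simplicity of \<open>M\<close> gives \<open>d = m + 1\<close>
  (\<open>V_dim_eq\<close>), and \<open>H v\<^sub>d\<close> is the span of the \<open>v\<^sub>i\<close> with \<open>i \<ge> d\<close> since \<open>y\<close> kills \<open>v\<^sub>d\<close>. So
  the kernel is \<open>H v\<^sub>d\<close>, and \<open>M\<close> is the quotient of \<open>V(\<rho>)\<close> by it.
\<close>

section \<open>Quotients by kernels\<close>

text \<open>
  The isomorphism sends an element of \<open>L\<close> to its fibre under \<open>h\<close>, which is a coset of the kernel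
  because any two members of it differ by an element of the kernel.
\<close>

lemma (in left_module) isomorphic_quotient_by_kernel:
  assumes N: "submodule N R M" and N_kernel: "N = {u \<in> carrier M. h u = \<zero>\<^bsub>L\<^esub>}"
    and L: "abelian_group L" and h_onto: "h ` carrier M = carrier L"
    and h_add: "\<And>u v. u \<in> carrier M \<Longrightarrow> v \<in> carrier M \<Longrightarrow> h (u \<oplus>\<^bsub>M\<^esub> v) = h u \<oplus>\<^bsub>L\<^esub> h v"
    and h_smult: "\<And>a u. a \<in> carrier R \<Longrightarrow> u \<in> carrier M \<Longrightarrow> h (a \<odot>\<^bsub>M\<^esub> u) = a \<odot>\<^bsub>L\<^esub> h u"
  shows "module_isomorphic R L (quotient_module M N)"
proof -
  have kernel_iff: "x \<in> N \<longleftrightarrow> x \<in> carrier M \<and> h x = \<zero>\<^bsub>L\<^esub>" for x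
    by (subst N_kernel) simp
  interpret L: abelian_group L by fact
  interpret N: submodule N R M by fact
  interpret N: abelian_subgroup N M
    by (intro abelian_subgroupI3 additive_subgroup.intro N.subgroup_axioms M.abelian_group_axioms)
  define \<phi> where "\<phi> w = {u \<in> carrier M. h u = w}" for w
  have h_closed: "h u \<in> carrier L" if "u \<in> carrier M" for u
    using that h_onto by blast
  have h_surj: "\<exists>u. u \<in> carrier M \<and> h u = w" if "w \<in> carrier L" for w
    using that unfolding h_onto[symmetric] by blast
  have fibre: "\<phi> (h u) = N +>\<^bsub>M\<^esub> u" if u: "u \<in> carrier M" for u
  proof (intro equalityI subsetI)
    fix w assume "w \<in> \<phi> (h u)"
    then have w: "w \<in> carrier M" "h w = h u"
      by (simp_all add: \<phi>_def)
    have w_eq: "w = (w \<ominus>\<^bsub>M\<^esub> u) \<oplus>\<^bsub>M\<^esub> u"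
      using w u by (simp add: M.minus_eq M.a_assoc M.l_neg)
    then have "h u = h (w \<ominus>\<^bsub>M\<^esub> u) \<oplus>\<^bsub>L\<^esub> h u"
      using h_add[of "w \<ominus>\<^bsub>M\<^esub> u" u] w u by simp
    then have "h (w \<ominus>\<^bsub>M\<^esub> u) = \<zero>\<^bsub>L\<^esub>"
      using w u h_closed by (metis L.add.r_cancel_one M.minus_closed)
    then have "w \<ominus>\<^bsub>M\<^esub> u \<in> N"
      using w u kernel_iff by blast
    with w_eq show "w \<in> N +>\<^bsub>M\<^esub> u"
      by (auto simp: a_r_coset_def')
  next
    fix w assume "w \<in> N +>\<^bsub>M\<^esub> u"
    then obtain n where "n \<in> N" and w: "w = n \<oplus>\<^bsub>M\<^esub> u"
      by (auto simp: a_r_coset_def')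
    then have "n \<in> carrier M" "h n = \<zero>\<^bsub>L\<^esub>"
      using kernel_iff by blast+
    then show "w \<in> \<phi> (h u)"
      using u h_closed by (simp add: \<phi>_def w h_add)
  qed
  have "bij_betw \<phi> (carrier L) (carrier (quotient_module M N))"
  proof (rule bij_betw_imageI)
    show "inj_on \<phi> (carrier L)"
    proof (rule inj_onI)
      fix w w' assume "w \<in> carrier L" and eq: "\<phi> w = \<phi> w'"
      then obtain u where "u \<in> carrier M" "h u = w"
        using h_surj[of w] by metis
      then have "u \<in> \<phi> w'"
        unfolding eq[symmetric] by (simp add: \<phi>_def)
      then show "w = w'"
        using \<open>h u = w\<close> by (simp add: \<phi>_def)
    qed
    have "\<phi> ` carrier L = (\<lambda>u. N +>\<^bsub>M\<^esub> u) ` carrier M"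
      unfolding h_onto[symmetric] image_image by (rule image_cong[OF refl fibre])
    then show "\<phi> ` carrier L = carrier (quotient_module M N)"
      by (auto simp: quotient_module_def A_RCOSETS_def' a_r_coset_def')
  qed
  moreover have "\<phi> (w \<oplus>\<^bsub>L\<^esub> w') = \<phi> w \<oplus>\<^bsub>quotient_module M N\<^esub> \<phi> w'"
    if w: "w \<in> carrier L" "w' \<in> carrier L" for w w'
  proof -
    obtain u u' where "u \<in> carrier M" "h u = w" "u' \<in> carrier M" "h u' = w'"
      using h_surj[OF w(1)] h_surj[OF w(2)] by metis
    then show ?thesis
      using fibre[of "u \<oplus>\<^bsub>M\<^esub> u'"] N.a_rcos_sum[of u u']
      by (auto simp: h_add quotient_module_def fibre)
  qed
  moreover have "\<phi> (a \<odot>\<^bsub>L\<^esub> w) = a \<odot>\<^bsub>quotient_module M N\<^esub> \<phi> w"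
    if aw: "a \<in> carrier R" "w \<in> carrier L" for a w
  proof -
    obtain u where "u \<in> carrier M" "h u = w"
      using h_surj[OF aw(2)] by metis
    then show ?thesis
      using aw fibre[of "a \<odot>\<^bsub>M\<^esub> u"] quotient_module_smult[OF N]
      by (auto simp: h_smult fibre)
  qed
  ultimately show ?thesis
    unfolding module_isomorphic_def by blast
qed

section \<open>Linear functionals on polynomials\<close>

text \<open>
  Finitely many linear conditions cannot cut the infinite dimensional space of polynomials down to
  zero. The induction step eliminates the new functional from two common zeros \<open>p\<close> and \<open>m q\<close> of the
  old ones. The second one is sought among the multiples of a power \<open>m\<close> of the indeterminate beyond
  the degree of \<open>p\<close>, so that no cancellation occurs in the leading coefficient.
\<close>

lemma common_zero_of_linear_functionals:
  fixes L :: "'v \<Rightarrow> 'k::field poly \<Rightarrow> 'k"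
  assumes "finite B"
    and "\<And>v p q. v \<in> B \<Longrightarrow> L v (p + q) = L v p + L v q"
    and "\<And>v r p. v \<in> B \<Longrightarrow> L v (Polynomial.smult r p) = r * L v p"
  shows "\<exists>p. p \<noteq> 0 \<and> (\<forall>v\<in>B. L v p = 0)"
  using assms
proof (induction B arbitrary: L rule: finite_induct)
  case empty
  show ?case by (intro exI[of _ 1]) simp
next
  case (insert x B)
  obtain p where p: "p \<noteq> 0" "\<forall>v\<in>B. L v p = 0"
    using insert.IH[of L] insert.prems by auto
  define m where "m = Polynomial.monom (1::'k) (Suc (Polynomial.degree p))"
  have "\<exists>q. q \<noteq> 0 \<and> (\<forall>v\<in>B. L v (m * q) = 0)"
    by (rule insert.IH) (use insert.prems in \<open>simp_all add: distrib_left\<close>)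
  then obtain q where q: "q \<noteq> 0" "\<forall>v\<in>B. L v (m * q) = 0"
    by blast
  show ?case
  proof (cases "L x p = 0")
    case True
    then show ?thesis using p by auto
  next
    case False
    define w where "w = Polynomial.smult (L x p) (m * q) + Polynomial.smult (- L x (m * q)) p"
    let ?n = "Polynomial.degree (m * q)"
    have "m \<noteq> 0" "Polynomial.degree m = Suc (Polynomial.degree p)"
      by (simp_all add: m_def Polynomial.degree_monom_eq monom_eq_0_iff)
    then have "?n > Polynomial.degree p"
      using q(1) by (simp add: degree_mult_eq)
    then have "Polynomial.coeff w ?n = L x p * lead_coeff (m * q)"
      by (simp add: w_def coeff_eq_0)
    then have "w \<noteq> 0"
      using False q(1) \<open>m \<noteq> 0\<close> by auto
    moreover have "L v w = L x p * L v (m * q) + - L x (m * q) * L v p" if "v \<in> insert x B" for v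
      unfolding w_def using that by (simp only: insert.prems)
    then have "\<forall>v\<in>insert x B. L v w = 0"
      using p q by auto
    ultimately show ?thesis by blast
  qed
qed

lemma sum_coeffs_superset:
  fixes \<phi> :: "nat \<Rightarrow> 'k::zero \<Rightarrow> 'b::comm_monoid_add"
  assumes "\<And>i. \<phi> i 0 = 0" "Polynomial.degree p \<le> n"
  shows "(\<Sum>i\<le>Polynomial.degree p. \<phi> i (Polynomial.coeff p i)) = (\<Sum>i\<le>n. \<phi> i (Polynomial.coeff p i))"
  using assms by (intro sum.mono_neutral_left) (auto simp: coeff_eq_0)

lemma sum_coeffs_add:
  fixes \<phi> :: "nat \<Rightarrow> 'k::comm_ring_1 \<Rightarrow> 'b::comm_monoid_add"
  assumes "\<And>i. \<phi> i 0 = 0" "\<And>i r s. \<phi> i (r + s) = \<phi> i r + \<phi> i s"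
  shows "(\<Sum>i\<le>Polynomial.degree (p + q). \<phi> i (Polynomial.coeff (p + q) i)) =
    (\<Sum>i\<le>Polynomial.degree p. \<phi> i (Polynomial.coeff p i)) +
    (\<Sum>i\<le>Polynomial.degree q. \<phi> i (Polynomial.coeff q i))"
proof -
  define n where "n = max (Polynomial.degree p) (Polynomial.degree q)"
  have "Polynomial.degree p \<le> n" "Polynomial.degree q \<le> n" "Polynomial.degree (p + q) \<le> n"
    by (auto simp: n_def degree_add_le_max)
  note superset = this[THEN sum_coeffs_superset[of \<phi>, OF assms(1)]]
  show ?thesis
    unfolding superset by (simp add: assms(2) sum.distrib)
qed

section \<open>Scalars and polynomials in the free algebra\<close>

lemma const_add: "const (r + s) = const r + const s"
  by (simp add: const_def single_add)

lemma const_mult: "const (r * s) = const r * const s"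
  by (simp add: const_def mult_single)

lemma const_0 [simp]: "const 0 = 0"
  by (simp add: const_def)

lemma const_1 [simp]: "const 1 = 1"
  by (simp add: const_def)

lemma const_uminus: "const (- r) = - const r"
  using const_add[of r "- r"] by (simp add: eq_neg_iff_add_eq_0 add.commute)

lemma const_commute: "const r * a = a * const r"
  by (rule additive_eqI[where f = "\<lambda>a. const r * a" and h = "\<lambda>a. a * const r"])
     (simp_all add: algebra_simps const_def mult_single)

lemma const_left_commute: "a * (const r * p) = const r * (a * p)"
  by (metis const_commute mult.assoc)

lemma scale_eq_const_mult: "scale r a = const r * a"
  by (rule additive_eqI[where f = "scale r" and h = "\<lambda>a. const r * a"])
     (simp_all add: algebra_simps const_def mult_single)

definition poly_in :: "('g, 'k::field) free_algebra \<Rightarrow> 'k poly \<Rightarrow> ('g, 'k) free_algebra" where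
  "poly_in z p = (\<Sum>i\<le>Polynomial.degree p. const (Polynomial.coeff p i) * z ^ i)"

lemma poly_in_add: "poly_in z (p + q) = poly_in z p + poly_in z q"
  unfolding poly_in_def
  by (rule sum_coeffs_add[of "\<lambda>i r. const r * z ^ i"]) (simp_all add: const_add distrib_right)

lemma poly_in_smult: "poly_in z (Polynomial.smult r p) = const r * poly_in z p"
  by (cases "r = 0") (simp_all add: poly_in_def const_mult sum_distrib_left mult.assoc)

lemma poly_in_shift: "poly_in z (pCons 0 p) = poly_in z p * z"
proof (cases "p = 0")
  case False
  then have "poly_in z (pCons 0 p) =
      (\<Sum>i\<le>Suc (Polynomial.degree p). const (Polynomial.coeff (pCons 0 p) i) * z ^ i)"
    by (simp add: poly_in_def)
  also have "\<dots> = poly_in z p * z"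
    unfolding sum.atMost_Suc_shift
    by (simp add: poly_in_def sum_distrib_right mult.assoc power_Suc2 del: power_Suc)
  finally show ?thesis .
qed (simp add: poly_in_def)

lemma poly_in_linear_factor: "poly_in z ([:- r, 1:] * p) = poly_in z p * (z - const r)"
proof -
  have "[:- r, 1:] * p = Polynomial.smult (- r) p + pCons 0 p"
    by simp
  then show ?thesis
    by (simp only: poly_in_add poly_in_smult poly_in_shift)
       (simp add: const_uminus right_diff_distrib const_commute)
qed

lemma poly_in_const: "poly_in z [:r:] = const r"
  by (simp add: poly_in_def)

section \<open>Modules over the algebra\<close>

abbreviation "Hx \<equiv> gen Xgen"
abbreviation "Hy \<equiv> gen Ygen"
abbreviation "Hg g \<equiv> gen (Ggen g)"

locale H_module = left_module "H_alg \<chi> b c" M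
  for \<chi> :: "'g::ab_group_add \<Rightarrow> 'k::field" and b c :: 'g
    and M :: "(('g, 'k) free_algebra set, 'm) module" +
  assumes character: "is_character \<chi>"
begin

text \<open>
  Elements of the free algebra act through their classes, so that equalities between operators
  on \<open>M\<close> can be checked with the arithmetic of a type.
\<close>

definition act :: "('g, 'k) free_algebra \<Rightarrow> 'm \<Rightarrow> 'm" where
  "act a u = H_class \<chi> b c a \<odot>\<^bsub>M\<^esub> u"

lemma class_closed [simp]: "H_class \<chi> b c a \<in> carrier (H_alg \<chi> b c)"
  by (simp add: H_alg_simps)

lemma act_closed [simp]: "u \<in> carrier M \<Longrightarrow> act a u \<in> carrier M"
  by (simp add: act_def)

lemma act_add_left: "u \<in> carrier M \<Longrightarrow> act (p + q) u = act p u \<oplus>\<^bsub>M\<^esub> act q u"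
  by (simp add: act_def smult_l_distr flip: H_alg_simps(4))

lemma act_add: "u \<in> carrier M \<Longrightarrow> v \<in> carrier M \<Longrightarrow> act a (u \<oplus>\<^bsub>M\<^esub> v) = act a u \<oplus>\<^bsub>M\<^esub> act a v"
  by (simp add: act_def smult_r_distr)

lemma act_mult: "u \<in> carrier M \<Longrightarrow> act (p * q) u = act p (act q u)"
  by (simp add: act_def smult_assoc1 flip: H_alg_simps(3))

lemma act_1 [simp]: "u \<in> carrier M \<Longrightarrow> act 1 u = u"
  by (simp add: act_def flip: H_alg_simps(2))

lemma act_0_left [simp]: assumes "u \<in> carrier M" shows "act 0 u = \<zero>\<^bsub>M\<^esub>"
proof -
  have "act 0 u \<oplus>\<^bsub>M\<^esub> act 0 u = act 0 u"
    using act_add_left[of u 0 0] assms by simp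
  then show ?thesis
    using assms by (metis M.add.l_cancel_one act_closed)
qed

lemma act_0 [simp]: "act a \<zero>\<^bsub>M\<^esub> = \<zero>\<^bsub>M\<^esub>"
  by (metis M.zero_closed act_0_left act_mult mult_zero_right)

lemma act_diff_left_eq_0_iff:
  assumes "u \<in> carrier M"
  shows "act (p - q) u = \<zero>\<^bsub>M\<^esub> \<longleftrightarrow> act p u = act q u"
proof -
  have "act p u = act (p - q) u \<oplus>\<^bsub>M\<^esub> act q u"
    using act_add_left[of u "p - q" q] assms by simp
  then show ?thesis
    using assms by (metis M.add.r_cancel_one act_closed)
qed

lemma act_const_eq_0_iff:
  assumes "u \<in> carrier M"
  shows "act (const r) u = \<zero>\<^bsub>M\<^esub> \<longleftrightarrow> r = 0 \<or> u = \<zero>\<^bsub>M\<^esub>"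
proof -
  have "u = \<zero>\<^bsub>M\<^esub>" if "r \<noteq> 0" "act (const r) u = \<zero>\<^bsub>M\<^esub>"
  proof -
    have "u = act (const (inverse r * r)) u"
      using that assms by simp
    also have "\<dots> = \<zero>\<^bsub>M\<^esub>"
      using that assms by (simp only: const_mult act_mult act_0)
    finally show ?thesis .
  qed
  then show ?thesis
    using assms by auto
qed

lemma act_const_cancel:
  assumes "u \<in> carrier M" "u \<noteq> \<zero>\<^bsub>M\<^esub>" "act (const r) u = act (const s) u"
  shows "r = s"
proof -
  have "act (const (r - s)) u = \<zero>\<^bsub>M\<^esub>"
    using assms act_diff_left_eq_0_iff[of u "const r" "const s"]
    by (simp add: const_def single_diff)
  then show ?thesis
    using assms by (simp add: act_const_eq_0_iff)
qed

lemma act_finsum: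
  assumes "finite B" "B \<subseteq> carrier M" "\<And>v. v \<in> B \<Longrightarrow> g v \<in> carrier M"
  shows "act a (\<Oplus>\<^bsub>M\<^esub>v\<in>B. g v) = (\<Oplus>\<^bsub>M\<^esub>v\<in>B. act a (g v))"
  using assms by (induction B rule: finite_induct) (auto simp: act_add Pi_def)

lemma act_relator:
  assumes "p - q \<in> relators \<chi> b c" "u \<in> carrier M"
  shows "act p u = act q u"
proof -
  have "p - q \<in> rel_ideal \<chi> b c"
    unfolding rel_ideal_def using assms(1)
    by (intro subsetD[OF ring.genideal_self[OF ring_ring_of_type_algebra]]) auto
  then have "p \<in> H_class \<chi> b c q"
    by (auto simp: H_class_eq intro!: exI[of _ "p - q"])
  then have "H_class \<chi> b c q = H_class \<chi> b c p"
    unfolding H_class_def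
    using abelian_group.a_repr_independence[OF ring.is_abelian_group[OF ring_ring_of_type_algebra]]
      additive_subgroup.a_subgroup[OF ideal.axioms(1)[OF rel_ideal_ideal]]
    by (metis ring_of_type_algebra_simps(1) UNIV_I)
  then show ?thesis
    by (simp add: act_def)
qed


lemma act_g_0: "u \<in> carrier M \<Longrightarrow> act (Hg 0) u = u"
  using act_relator[of "Hg 0" 1 u] by (auto simp: relators_def)

lemma act_g_add:
  assumes "u \<in> carrier M"
  shows "act (Hg (g + h)) u = act (Hg g) (act (Hg h) u)"
proof -
  have "Hg g * Hg h - Hg (g + h) \<in> relators \<chi> b c"
    unfolding relators_def by blast
  then show ?thesis
    using act_relator assms by (metis act_mult)
qed

lemma act_x_g: "u \<in> carrier M \<Longrightarrow> act Hx (act (Hg g) u) = act (const (\<chi> g)) (act (Hg g) (act Hx u))"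
  using act_relator[of "Hx * Hg g" "const (\<chi> g) * Hg g * Hx" u] by (auto simp: relators_def act_mult)

lemma act_y_g:
  "u \<in> carrier M \<Longrightarrow> act Hy (act (Hg g) u) = act (const (inverse (\<chi> g))) (act (Hg g) (act Hy u))"
  using act_relator[of "Hy * Hg g" "const (inverse (\<chi> g)) * Hg g * Hy" u]
  by (auto simp: relators_def act_mult)

lemma act_y_x:
  assumes "u \<in> carrier M"
  shows "act Hy (act Hx u) = act Hx (act Hy u) \<oplus>\<^bsub>M\<^esub> act (Hg (- c) - Hg b) u"
proof -
  have e: "lin_ext (\<lambda>g. Hg g) (e_elem b c) = Hg (- c) - Hg b"
    by (simp add: e_elem_def lin_ext_diff)
  have "act (Hy * Hx) u = act (Hx * Hy + (Hg (- c) - Hg b)) u"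
    using assms by (intro act_relator) (auto simp: relators_def e)
  then show ?thesis
    using assms by (simp add: act_mult act_add_left)
qed

lemma act_const_commute: "u \<in> carrier M \<Longrightarrow> act a (act (const r) u) = act (const r) (act a u)"
  by (metis act_mult const_commute)

lemma act_g_x:
  assumes "u \<in> carrier M"
  shows "act (Hg g) (act Hx u) = act (const (inverse (\<chi> g))) (act Hx (act (Hg g) u))"
proof -
  have "act (const (inverse (\<chi> g))) (act Hx (act (Hg g) u)) =
      act (const (inverse (\<chi> g) * \<chi> g)) (act (Hg g) (act Hx u))"
    using assms by (simp add: act_x_g const_mult act_mult)
  also have "\<dots> = act (Hg g) (act Hx u)"
    using assms character by (simp add: is_character_def)
  finally show ?thesis ..
qed

lemma last_nonzero_power:
  assumes "torsion_module (H_alg \<chi> b c) (H_class \<chi> b c z) M" "u \<in> carrier M" "u \<noteq> \<zero>\<^bsub>M\<^esub>"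
  obtains m where "act (z ^ m) u \<noteq> \<zero>\<^bsub>M\<^esub>" "act (z ^ Suc m) u = \<zero>\<^bsub>M\<^esub>"
proof -
  have pow: "H_class \<chi> b c z [^]\<^bsub>H_alg \<chi> b c\<^esub> k = H_class \<chi> b c (z ^ k)" for k :: nat
    by (induction k) (simp_all add: H_alg_simps power_Suc2 del: power_Suc)
  obtain k where k: "act (z ^ k) u = \<zero>\<^bsub>M\<^esub>"
    using assms(1,2) unfolding torsion_module_def pow act_def by blast
  define k0 where "k0 = (LEAST k. act (z ^ k) u = \<zero>\<^bsub>M\<^esub>)"
  have k0: "act (z ^ k0) u = \<zero>\<^bsub>M\<^esub>"
    unfolding k0_def by (rule LeastI[of _ k]) (rule k)
  then obtain m where m: "k0 = Suc m"
    using assms(2,3) by (cases k0) auto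
  then have "act (z ^ m) u \<noteq> \<zero>\<^bsub>M\<^esub>"
    using not_less_Least[of m "\<lambda>k. act (z ^ k) u = \<zero>\<^bsub>M\<^esub>"] by (simp add: k0_def)
  then show ?thesis
    using that k0 m by blast
qed

lemma simple_module_generated:
  assumes "simple_module (H_alg \<chi> b c) M" "u \<in> carrier M" "u \<noteq> \<zero>\<^bsub>M\<^esub>" "w \<in> carrier M"
  obtains a where "w = act a u"
proof -
  have "u \<in> cyclic_submodule (H_alg \<chi> b c) M u"
    unfolding cyclic_submodule_def using assms(2)
    by (auto intro!: exI[of _ "\<one>\<^bsub>H_alg \<chi> b c\<^esub>"])
  then have "cyclic_submodule (H_alg \<chi> b c) M u = carrier M"
    using assms(1-3) submodule_cyclic[of u] by (auto simp: simple_module_def)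
  then show ?thesis
    using assms(4) that by (auto simp: cyclic_submodule_def H_alg_simps act_def)
qed

end

section \<open>Common eigenvectors of the group\<close>

context H_module
begin

text \<open>
  For \<open>u \<in> M\<close> the coordinates of \<open>p(z) u\<close> with respect to a finite spanning set are linear
  functionals of the polynomial \<open>p\<close>, hence vanish together for some nonzero \<open>p\<close>.
\<close>

lemma exists_annihilating_poly:
  assumes "finite_dim_module (\<lambda>r. H_class \<chi> b c (const r)) M" and u: "u \<in> carrier M"
  shows "\<exists>p. p \<noteq> 0 \<and> act (poly_in z p) u = \<zero>\<^bsub>M\<^esub>"
proof -
  obtain B where B: "finite B" "B \<subseteq> carrier M"
    and span: "\<And>u. u \<in> carrier M \<Longrightarrow> \<exists>f. u = (\<Oplus>\<^bsub>M\<^esub>v\<in>B. act (const (f v)) v)"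
    using assms(1) unfolding finite_dim_module_def act_def by blast
  have Bc: "v \<in> carrier M" if "v \<in> B" for v
    using that B(2) by blast
  have "\<forall>i. \<exists>f. act (z ^ i) u = (\<Oplus>\<^bsub>M\<^esub>v\<in>B. act (const (f v)) v)"
    using span u by simp
  then obtain f where f: "\<And>i. act (z ^ i) u = (\<Oplus>\<^bsub>M\<^esub>v\<in>B. act (const (f i v)) v)"
    by metis
  have monomial: "act (const r * z ^ i) u = (\<Oplus>\<^bsub>M\<^esub>v\<in>B. act (const (r * f i v)) v)" for r i
  proof -
    have "act (const r * z ^ i) u = (\<Oplus>\<^bsub>M\<^esub>v\<in>B. act (const r) (act (const (f i v)) v))"
      using u Bc by (simp only: act_mult f act_closed) (rule act_finsum[OF B], simp)
    also have "\<dots> = (\<Oplus>\<^bsub>M\<^esub>v\<in>B. act (const (r * f i v)) v)"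
      using Bc by (intro M.finsum_cong') (auto simp: const_mult act_mult)
    finally show ?thesis .
  qed
  have coords: "act (\<Sum>i\<le>k. const (a i) * z ^ i) u = (\<Oplus>\<^bsub>M\<^esub>v\<in>B. act (const (\<Sum>i\<le>k. a i * f i v)) v)"
    for a k
  proof (induction k)
    case 0
    show ?case using monomial[of "a 0" 0] by simp
  next
    case (Suc k)
    have "act (\<Sum>i\<le>Suc k. const (a i) * z ^ i) u =
        (\<Oplus>\<^bsub>M\<^esub>v\<in>B. act (const (\<Sum>i\<le>k. a i * f i v)) v) \<oplus>\<^bsub>M\<^esub>
        (\<Oplus>\<^bsub>M\<^esub>v\<in>B. act (const (a (Suc k) * f (Suc k) v)) v)"
      using u unfolding sum.atMost_Suc by (simp only: act_add_left Suc.IH monomial)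
    also have "\<dots> = (\<Oplus>\<^bsub>M\<^esub>v\<in>B. act (const (\<Sum>i\<le>k. a i * f i v)) v \<oplus>\<^bsub>M\<^esub>
        act (const (a (Suc k) * f (Suc k) v)) v)"
      using Bc by (intro M.finsum_addf[symmetric]) auto
    also have "\<dots> = (\<Oplus>\<^bsub>M\<^esub>v\<in>B. act (const (\<Sum>i\<le>Suc k. a i * f i v)) v)"
      using Bc by (intro M.finsum_cong') (auto simp: const_add act_add_left)
    finally show ?case .
  qed
  define L where "L v p = (\<Sum>i\<le>Polynomial.degree p. Polynomial.coeff p i * f i v)" for v p
  have "\<exists>p. p \<noteq> 0 \<and> (\<forall>v\<in>B. L v p = 0)"
  proof (rule common_zero_of_linear_functionals[OF B(1)])
    show "L v (p + q) = L v p + L v q" for v p q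
      unfolding L_def by (rule sum_coeffs_add[of "\<lambda>i r. r * f i v"]) (simp_all add: distrib_right)
    show "L v (Polynomial.smult r p) = r * L v p" for v r p
      by (cases "r = 0") (simp_all add: L_def sum_distrib_left mult.assoc)
  qed
  then obtain p where "p \<noteq> 0" "\<forall>v\<in>B. L v p = 0"
    by blast
  moreover from this have "(\<Oplus>\<^bsub>M\<^esub>v\<in>B. act (const (L v p)) v) = (\<Oplus>\<^bsub>M\<^esub>v\<in>B. \<zero>\<^bsub>M\<^esub>)"
    using Bc by (intro M.finsum_cong') (auto simp:)
  ultimately show ?thesis
    using coords[of "Polynomial.coeff p" "Polynomial.degree p"]
    by (auto simp: poly_in_def L_def)
qed

end

locale H_module_alg_closed = H_module \<chi> b c M
  for \<chi> :: "'g::ab_group_add \<Rightarrow> 'k::alg_closed_field" and b c :: 'g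
    and M :: "(('g, 'k) free_algebra set, 'm) module"
begin

text \<open>
  Split off a root \<open>r\<close> of \<open>p\<close>: either \<open>u\<close> is an eigenvector for \<open>r\<close>, or
  \<open>(z - r) u\<close> is a nonzero vector annihilated by a polynomial of smaller degree.
\<close>

lemma eigenvector_of_annihilating_poly:
  assumes U: "U \<subseteq> carrier M"
      "\<And>u v. u \<in> U \<Longrightarrow> v \<in> U \<Longrightarrow> u \<oplus>\<^bsub>M\<^esub> v \<in> U"
      "\<And>r u. u \<in> U \<Longrightarrow> act (const r) u \<in> U"
      "\<And>u. u \<in> U \<Longrightarrow> act z u \<in> U"
    and "p \<noteq> 0" "u \<in> U" "u \<noteq> \<zero>\<^bsub>M\<^esub>" "act (poly_in z p) u = \<zero>\<^bsub>M\<^esub>"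
  shows "\<exists>w\<in>U. w \<noteq> \<zero>\<^bsub>M\<^esub> \<and> (\<exists>r. act z w = act (const r) w)"
  using assms(5-)
proof (induction "Polynomial.degree p" arbitrary: p u)
  case 0
  then obtain r where "p = [:r:]" "r \<noteq> 0"
    by (metis degree_eq_zeroE pCons_0_0)
  then show ?case
    using 0 U(1) by (auto simp: poly_in_const act_const_eq_0_iff)
next
  case (Suc k)
  have u: "u \<in> carrier M"
    using Suc.prems U(1) by blast
  obtain r where "poly p r = 0"
    using alg_closed_imp_poly_has_root[of p] Suc.hyps(2) by auto
  then obtain q where q: "p = [:- r, 1:] * q"
    by (auto simp: poly_eq_0_iff_dvd elim: dvdE)
  with Suc.prems have "q \<noteq> 0"
    by auto
  then have "Polynomial.degree p = Suc (Polynomial.degree q)"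
    unfolding q by (subst degree_mult_eq) auto
  then have deg: "k = Polynomial.degree q"
    using Suc.hyps(2) by simp
  show ?case
  proof (cases "act (z - const r) u = \<zero>\<^bsub>M\<^esub>")
    case True
    then show ?thesis
      using Suc.prems u by (auto simp: act_diff_left_eq_0_iff)
  next
    case False
    have "z - const r = z + const (- r)"
      by (simp add: const_uminus)
    then have "act (z - const r) u = act z u \<oplus>\<^bsub>M\<^esub> act (const (- r)) u"
      using act_add_left[OF u] by metis
    then have "act (z - const r) u \<in> U"
      using U Suc.prems(2) by simp
    moreover have "act (poly_in z q) (act (z - const r) u) = \<zero>\<^bsub>M\<^esub>"
      using Suc.prems(4) u unfolding q poly_in_linear_factor by (simp add: act_mult)
    ultimately show ?thesis
      using Suc.hyps(1)[OF deg \<open>q \<noteq> 0\<close>] False by blast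
  qed
qed

text \<open>
  The kernel of \<open>y\<close> is stable under \<open>G\<close> because \<open>y g = \<chi>(g)\<^sup>-\<^sup>1 g y\<close>, and within it the common
  eigenspace of finitely many group elements is stable under every further one.
\<close>

lemma common_eigenvector_of_finite_set:
  assumes dim: "finite_dim_module (\<lambda>r. H_class \<chi> b c (const r)) M"
    and "u0 \<in> carrier M" "u0 \<noteq> \<zero>\<^bsub>M\<^esub>" "act Hy u0 = \<zero>\<^bsub>M\<^esub>" and "finite S"
  shows "\<exists>u r. u \<in> carrier M \<and> u \<noteq> \<zero>\<^bsub>M\<^esub> \<and> act Hy u = \<zero>\<^bsub>M\<^esub> \<and>
    (\<forall>g\<in>S. act (Hg g) u = act (const (r g)) u)"
  using \<open>finite S\<close>
proof (induction S rule: finite_induct)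
  case empty
  show ?case using assms(2-4) by auto
next
  case (insert h S)
  then obtain u r where u: "u \<in> carrier M" "u \<noteq> \<zero>\<^bsub>M\<^esub>" "act Hy u = \<zero>\<^bsub>M\<^esub>"
      "\<forall>g\<in>S. act (Hg g) u = act (const (r g)) u"
    by blast
  define U where "U = {w \<in> carrier M. act Hy w = \<zero>\<^bsub>M\<^esub> \<and> (\<forall>g\<in>S. act (Hg g) w = act (const (r g)) w)}"
  obtain p where p: "p \<noteq> 0" "act (poly_in (Hg h) p) u = \<zero>\<^bsub>M\<^esub>"
    using exists_annihilating_poly[OF dim u(1)] by blast
  have "\<exists>w\<in>U. w \<noteq> \<zero>\<^bsub>M\<^esub> \<and> (\<exists>s. act (Hg h) w = act (const s) w)"
  proof (rule eigenvector_of_annihilating_poly[OF _ _ _ _ p(1) _ u(2) p(2)])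
    show "act (Hg h) w \<in> U" if w: "w \<in> U" for w
    proof -
      have "act (Hg g) (act (Hg h) w) = act (const (r g)) (act (Hg h) w)" if "g \<in> S" for g
      proof -
        have "act (Hg g) (act (Hg h) w) = act (Hg h) (act (Hg g) w)"
          using w by (auto simp: U_def add.commute simp flip: act_g_add)
        also have "\<dots> = act (const (r g)) (act (Hg h) w)"
          using w that by (simp add: U_def act_const_commute[where a = "Hg h" for h])
        finally show ?thesis .
      qed
      then show ?thesis
        using w by (simp add: U_def act_y_g)
    qed
    show "act (const s) w \<in> U" if w: "w \<in> U" for s w
    proof -
      have "act (Hg g) (act (const s) w) = act (const (r g)) (act (const s) w)" if "g \<in> S" for g
        using w that act_const_commute[of w "Hg g" s] act_const_commute[of w "const (r g)" s]
        by (simp add: U_def)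
      then show ?thesis
        using w act_const_commute[of w Hy s] by (simp add: U_def)
    qed
  qed (use u in \<open>auto simp: U_def act_add\<close>)
  then obtain w s where w: "w \<in> U" "w \<noteq> \<zero>\<^bsub>M\<^esub>" "act (Hg h) w = act (const s) w"
    by blast
  then show ?case
    using insert.hyps(2) by (intro exI[of _ w] exI[of _ "r(h := s)"]) (auto simp: U_def)
qed

lemma eigenvalue_of_negative:
  assumes "u \<in> carrier M" "u \<noteq> \<zero>\<^bsub>M\<^esub>" "act (Hg g) u = act (const r) u"
  shows "r \<noteq> 0" "act (Hg (- g)) u = act (const (inverse r)) u"
proof -
  have u: "act (const r) (act (Hg (- g)) u) = u"
    using assms act_g_add[of u "- g" g] by (simp add: act_g_0 act_const_commute[where a = "Hg h" for h])
  then show r: "r \<noteq> 0"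
    using assms by auto
  have "act (const (inverse r)) u = act (const (inverse r * r)) (act (Hg (- g)) u)"
    using assms u by (simp only: const_mult act_mult act_closed)
  then show "act (Hg (- g)) u = act (const (inverse r)) u"
    using r assms by simp
qed

text \<open>
  Common eigenvectors of the generators of \<open>G\<close> are common eigenvectors of \<open>G\<close>, and the
  eigenvalues are then multiplicative in the group element.
\<close>

lemma exists_weight_vector:
  assumes dim: "finite_dim_module (\<lambda>r. H_class \<chi> b c (const r)) M"
    and fin_gen: "\<exists>S::'g set. finite S \<and> group_closure S = UNIV"
    and "torsion_module (H_alg \<chi> b c) (H_class \<chi> b c Hy) M"
    and "carrier M \<noteq> {\<zero>\<^bsub>M\<^esub>}"
  obtains v \<rho> where "v \<in> carrier M" "v \<noteq> \<zero>\<^bsub>M\<^esub>" "act Hy v = \<zero>\<^bsub>M\<^esub>"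
    "is_character \<rho>" "\<And>g. act (Hg g) v = act (const (\<rho> g)) v"
proof -
  obtain u where u: "u \<in> carrier M" "u \<noteq> \<zero>\<^bsub>M\<^esub>"
    using assms(4) M.zero_closed by blast
  obtain m where "act (Hy ^ m) u \<noteq> \<zero>\<^bsub>M\<^esub>" "act Hy (act (Hy ^ m) u) = \<zero>\<^bsub>M\<^esub>"
    using last_nonzero_power[OF assms(3) u] u by (metis act_mult power_Suc)
  moreover obtain S :: "'g set" where S: "finite S" "group_closure S = UNIV"
    using fin_gen by blast
  ultimately obtain v r where v: "v \<in> carrier M" "v \<noteq> \<zero>\<^bsub>M\<^esub>" "act Hy v = \<zero>\<^bsub>M\<^esub>"
      and r: "\<forall>g\<in>S. act (Hg g) v = act (const (r g)) v"
    using common_eigenvector_of_finite_set[OF dim _ _ _ S(1), of "act (Hy ^ m) u"] u by auto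
  have "\<exists>s. act (Hg g) v = act (const s) v" if "g \<in> group_closure S" for g
    using that
  proof induction
    case (base g)
    show ?case
    proof (cases "g = 0")
      case True
      then show ?thesis using v by (auto simp: act_g_0 intro!: exI[of _ 1])
    next
      case False
      then show ?thesis using base r by auto
    qed
  next
    case (diff g h)
    then obtain s t where s: "act (Hg g) v = act (const s) v" and t: "act (Hg h) v = act (const t) v"
      by blast
    have "act (Hg (g - h)) v = act (const (inverse t * s)) v"
      using v s eigenvalue_of_negative[OF v(1,2) t] act_g_add[of v g "- h"]
      by (simp add: act_const_commute[where a = "Hg h" for h] const_mult act_mult)
    then show ?case by blast
  qed
  then have "\<forall>g. \<exists>s. act (Hg g) v = act (const s) v"
    by (simp add: S(2))
  then obtain \<rho> where \<rho>: "\<And>g. act (Hg g) v = act (const (\<rho> g)) v"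
    by metis
  have "\<rho> (g + h) = \<rho> g * \<rho> h" for g h
  proof (rule act_const_cancel[OF v(1,2)])
    have "act (Hg (g + h)) v = act (const (\<rho> h * \<rho> g)) v"
      unfolding act_g_add[OF v(1)]
      using v by (simp add: \<rho> act_const_commute[where a = "Hg h" for h] const_mult act_mult)
    then show "act (const (\<rho> (g + h))) v = act (const (\<rho> g * \<rho> h)) v"
      by (simp only: \<rho> mult.commute)
  qed
  then have "is_character \<rho>"
    using eigenvalue_of_negative(1)[OF v(1,2) \<rho>] by (simp add: is_character_def)
  then show ?thesis
    using that v \<rho> by blast
qed

end

section \<open>Vectors supported above a given index\<close>

lemma poly_mapping_additive_induct:
  assumes "\<And>a r. P (Poly_Mapping.single a r)" "\<And>u v. P u \<Longrightarrow> P v \<Longrightarrow> P (u + v)"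
  shows "P (u :: 'a \<Rightarrow>\<^sub>0 'k::comm_monoid_add)"
proof -
  have "P 0"
    using assms(1)[of undefined 0] by simp
  then have "P (sum f A)" if "\<And>a. a \<in> A \<Longrightarrow> P (f a)" for f :: "'a \<Rightarrow> 'a \<Rightarrow>\<^sub>0 'k" and A
    using that by (induction A rule: infinite_finite_induct) (auto intro: assms(2))
  then show ?thesis
    by (subst poly_mapping_sum_single) (simp add: assms(1))
qed

definition supported_from :: "nat \<Rightarrow> (nat \<Rightarrow>\<^sub>0 'k::zero) \<Rightarrow> bool" where
  "supported_from m u \<longleftrightarrow> (\<forall>i<m. Poly_Mapping.lookup u i = 0)"

text \<open>The vector \<open>u\<close>, regarded as a polynomial in \<open>x\<close>.\<close>

definition x_poly :: "(nat \<Rightarrow>\<^sub>0 'k) \<Rightarrow> ('g, 'k::field) free_algebra" where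
  "x_poly = lin_ext (\<lambda>i. Hx ^ i)"

lemma x_poly_simps [simp]:
  "x_poly (u + w) = x_poly u + x_poly w"
  "x_poly (scale r u) = scale r (x_poly u)"
  "x_poly (Poly_Mapping.single i r) = scale r (Hx ^ i)"
  by (simp_all add: x_poly_def lin_ext_add lin_ext_scale)

lemma x_poly_commute: "x_poly u * Hx ^ k = Hx ^ k * x_poly u"
  by (rule additive_eqI[where f = "\<lambda>u. x_poly u * Hx ^ k" and h = "\<lambda>u. Hx ^ k * x_poly u"])
     (simp_all add: distrib_left distrib_right scale_eq_const_mult mult.assoc const_left_commute
       add.commute flip: power_add)

lemma x_poly_divisible:
  assumes "supported_from m u"
  obtains q where "x_poly u = x_poly q * (Hx ^ m :: ('g, 'k::field) free_algebra)"
proof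
  let ?q = "\<Sum>i\<in>Poly_Mapping.keys u. Poly_Mapping.single (i - m) (Poly_Mapping.lookup u i)"
  have "i - m + m = i" if "i \<in> Poly_Mapping.keys u" for i
    using assms that by (metis in_keys_iff le_add_diff_inverse2 not_less supported_from_def)
  then show "x_poly u = x_poly ?q * (Hx ^ m :: ('g, 'k) free_algebra)"
    by (simp add: x_poly_def lin_ext_sum lin_ext_def[of _ u] sum_distrib_right scale_eq_const_mult
      mult.assoc flip: power_add)
qed

lemma V_act_x_poly: "V_act \<chi> b c \<rho> (x_poly u) (Poly_Mapping.single 0 1) = u"
proof (rule additive_eqI[where h = "\<lambda>u. u"])
  have "V_act \<chi> b c \<rho> (Hx ^ i) (Poly_Mapping.single 0 1) = Poly_Mapping.single i 1" for i
    by (induction i) (simp_all add: V_act_mult V_act_gen)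
  then show "V_act \<chi> b c \<rho> (x_poly (Poly_Mapping.single i r)) (Poly_Mapping.single 0 1) =
      Poly_Mapping.single i r" for i r
    by (simp add: scale_eq_const_mult V_act_mult)
qed (simp_all add: V_act_add_left)

text \<open>
  The span of \<open>v\<^sub>d, v\<^sub>d\<^sub>+\<^sub>1, \<dots>\<close> is a submodule because \<open>y\<close>, the only generator that lowers the index,
  sends \<open>v\<^sub>d\<close> to \<open>\<rho>([e]\<^sub>d) v\<^sub>d\<^sub>-\<^sub>1 = 0\<close>.
\<close>

lemma supported_from_V_act:
  assumes d: "char_ext \<rho> (sigma_bracket \<chi> (e_elem b c) d) = 0" and u: "supported_from d u"
  shows "supported_from d (V_act \<chi> b c \<rho> a u)"
proof -
  have add: "supported_from d (u + w)" if "supported_from d u" "supported_from d w"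
    for u w :: "nat \<Rightarrow>\<^sub>0 'a"
    using that by (simp add: supported_from_def lookup_add)
  have gen: "supported_from d (lin_ext (V_gen_basis \<chi> b c \<rho> z) w)" if w: "supported_from d w" for z w
  proof -
    have "Poly_Mapping.lookup (V_gen_basis \<chi> b c \<rho> z i) j = 0" if "j < d" "i \<ge> d" for i j
      using that d by (cases z) (auto simp: lookup_single when_def le_less)
    moreover have "i \<ge> d" if "i \<in> Poly_Mapping.keys w" for i
      using w that by (metis in_keys_iff not_less supported_from_def)
    ultimately show ?thesis
      by (simp add: supported_from_def lin_ext_def lookup_sum)
  qed
  have word: "supported_from d (foldr (\<lambda>z. lin_ext (V_gen_basis \<chi> b c \<rho> z)) zs u)" for zs
    by (induction zs) (simp_all add: u gen)
  show ?thesis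
  proof (induction a rule: poly_mapping_additive_induct)
    case (1 w r)
    show ?case using word[of "letters w"] by (simp add: V_act_def supported_from_def)
  qed (simp add: V_act_add_left add)
qed

section \<open>The homomorphism defined by a weight vector\<close>

locale weight_vector = H_module \<chi> b c M
  for \<chi> :: "'g::ab_group_add \<Rightarrow> 'k::field" and b c :: 'g
    and M :: "(('g, 'k) free_algebra set, 'm) module" +
  fixes v :: 'm and \<rho> :: "'g \<Rightarrow> 'k"
  assumes v_carrier [simp]: "v \<in> carrier M" and v_nonzero: "v \<noteq> \<zero>\<^bsub>M\<^esub>"
    and y_v: "act Hy v = \<zero>\<^bsub>M\<^esub>"
    and weight: "is_character \<rho>"
    and g_v: "act (Hg g) v = act (const (\<rho> g)) v"
begin

abbreviation "bracket i \<equiv> char_ext \<rho> (sigma_bracket \<chi> (e_elem b c) i)"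

lemma bracket_Suc:
  "bracket (Suc i) =
    bracket i + (inverse (\<chi> (- c)) ^ i * \<rho> (- c) - inverse (\<chi> b) ^ i * \<rho> b)"
proof -
  have "(inv_into UNIV (sigma \<chi>) ^^ i) (u - w) =
      (inv_into UNIV (sigma \<chi>) ^^ i) u - (inv_into UNIV (sigma \<chi>) ^^ i) w" for u w
    unfolding inv_sigma[OF character] by (induction i) (auto simp: sigma_def lin_ext_diff)
  then show ?thesis
    by (simp add: sigma_bracket_Suc e_elem_def inv_sigma_single[OF character] char_ext_add
      char_ext_diff)
qed

lemma bracket_0: "bracket 0 = 0"
  by (simp add: sigma_bracket_def char_ext_def)

lemma act_Hx_pow_Suc: "act (Hx ^ Suc i) v = act Hx (act (Hx ^ i) v)"
  by (simp add: act_mult)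

lemma act_g_pow: "act (Hg g) (act (Hx ^ i) v) = act (const (inverse (\<chi> g) ^ i * \<rho> g)) (act (Hx ^ i) v)"
proof (induction i)
  case 0
  show ?case by (simp add: g_v)
next
  case (Suc i)
  have "act (Hg g) (act (Hx ^ Suc i) v) =
      act (const (inverse (\<chi> g))) (act Hx (act (const (inverse (\<chi> g) ^ i * \<rho> g)) (act (Hx ^ i) v)))"
    unfolding act_Hx_pow_Suc by (simp add: act_g_x Suc.IH)
  also have "\<dots> = act (const (inverse (\<chi> g)) * const (inverse (\<chi> g) ^ i * \<rho> g)) (act (Hx ^ Suc i) v)"
    unfolding act_Hx_pow_Suc by (simp add: act_const_commute[where a = Hx] act_mult)
  finally show ?case
    by (simp add: mult.assoc flip: const_mult)
qed

text \<open>
  Moving \<open>y\<close> past the powers of \<open>x\<close> collects the eigenvalues of \<open>e\<close> on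
  \<open>v, x v, \<dots>\<close>, which are the summands of \<open>\<rho>([e]\<^sub>i)\<close>.
\<close>

lemma act_y_pow: "act Hy (act (Hx ^ Suc i) v) = act (const (bracket (Suc i))) (act (Hx ^ i) v)"
proof -
  have e: "act (Hg (- c) - Hg b) (act (Hx ^ i) v) =
      act (const (bracket (Suc i) - bracket i)) (act (Hx ^ i) v)" for i
  proof -
    let ?w = "act (Hx ^ i) v"
    let ?r = "inverse (\<chi> (- c)) ^ i * \<rho> (- c)" and ?s = "inverse (\<chi> b) ^ i * \<rho> b"
    have "act (Hg (- c) - Hg b) ?w \<oplus>\<^bsub>M\<^esub> act (const ?s) ?w = act (const ?r) ?w"
      using act_add_left[of ?w "Hg (- c) - Hg b" "Hg b"] by (simp add: act_g_pow)
    moreover have "act (const (?r - ?s)) ?w \<oplus>\<^bsub>M\<^esub> act (const ?s) ?w = act (const ?r) ?w"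
      using act_add_left[of ?w "const (?r - ?s)" "const ?s"] by (simp flip: const_add)
    ultimately have "act (Hg (- c) - Hg b) ?w = act (const (?r - ?s)) ?w"
      by (metis M.add.right_cancel act_closed v_carrier)
    then show ?thesis
      by (simp add: bracket_Suc)
  qed
  show ?thesis
  proof (induction i)
    case 0
    have "act Hy (act Hx v) = act Hx (act Hy v) \<oplus>\<^bsub>M\<^esub> act (const (bracket (Suc 0) - bracket 0)) v"
      using act_y_x[of v] e[of 0] by simp
    then show ?case
      by (simp add: y_v bracket_0)
  next
    case (Suc i)
    let ?w = "act (Hx ^ Suc i) v"
    have "act Hx (act Hy ?w) = act (const (bracket (Suc i))) ?w"
      unfolding Suc.IH unfolding act_Hx_pow_Suc by (simp add: act_const_commute[where a = Hx])
    then have "act Hy (act Hx ?w) =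
        act (const (bracket (Suc i))) ?w \<oplus>\<^bsub>M\<^esub> act (const (bracket (Suc (Suc i)) - bracket (Suc i))) ?w"
      using act_y_x[of ?w] e[of "Suc i"] by simp
    also have "\<dots> = act (const (bracket (Suc (Suc i)))) ?w"
      by (simp flip: act_add_left const_add)
    finally show ?case
      unfolding act_Hx_pow_Suc[of "Suc i"] .
  qed
qed

text \<open>The linear map with \<open>v\<^sub>i \<mapsto> x\<^sup>i v\<close>.\<close>

definition hom_V :: "(nat \<Rightarrow>\<^sub>0 'k) \<Rightarrow> 'm" where
  "hom_V u = act (x_poly u) v"

lemma hom_V_closed [simp]: "hom_V u \<in> carrier M"
  by (simp add: hom_V_def)

lemma hom_V_add: "hom_V (u + w) = hom_V u \<oplus>\<^bsub>M\<^esub> hom_V w"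
  by (simp add: hom_V_def act_add_left)

lemma hom_V_scale: "hom_V (scale r u) = act (const r) (hom_V u)"
  by (simp add: hom_V_def scale_eq_const_mult act_mult)

lemma hom_V_single: "hom_V (Poly_Mapping.single i r) = act (const r) (act (Hx ^ i) v)"
  by (simp add: hom_V_def scale_eq_const_mult act_mult)

lemma hom_V_0 [simp]: "hom_V 0 = \<zero>\<^bsub>M\<^esub>"
  using hom_V_scale[of 0 0] by simp

lemma hom_V_gen_basis: "hom_V (V_gen_basis \<chi> b c \<rho> z i) = act (gen z) (act (Hx ^ i) v)"
proof (cases z)
  case (Ggen g)
  then show ?thesis
    by (simp add: V_gen_basis_Ggen[OF character] hom_V_single act_g_pow del: V_gen_basis.simps)
next
  case Xgen
  then show ?thesis
    by (simp add: hom_V_single act_mult)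
next
  case Ygen
  then show ?thesis
    by (cases i) (simp_all add: y_v hom_V_single act_y_pow del: power_Suc)
qed

lemma hom_V_gen: "hom_V (lin_ext (V_gen_basis \<chi> b c \<rho> z) u) = act (gen z) (hom_V u)"
proof (induction u rule: poly_mapping_additive_induct)
  case (1 i r)
  show ?case
    by (simp add: hom_V_scale hom_V_gen_basis hom_V_single act_const_commute[where a = "gen z"])
qed (simp add: lin_ext_add hom_V_add act_add)

lemma hom_V_act: "hom_V (V_act \<chi> b c \<rho> a u) = act a (hom_V u)"
proof (induction a rule: poly_mapping_additive_induct)
  case (1 w r)
  have "hom_V (V_act \<chi> b c \<rho> (Poly_Mapping.single (Word zs) r) u) =
      act (Poly_Mapping.single (Word zs) r) (hom_V u)" for zs
  proof (induction zs)
    case Nil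
    have "Poly_Mapping.single (Word []) r = (const r :: ('g, 'k) free_algebra)"
      by (simp add: const_def zero_word_def)
    then show ?case
      by (simp add: hom_V_scale)
  next
    case (Cons z zs)
    have "Poly_Mapping.single (Word (z # zs)) r = gen z * (Poly_Mapping.single (Word zs) r :: ('g, 'k) free_algebra)"
      by (simp add: gen_def mult_single plus_word_def)
    then show ?case
      by (simp add: V_act_mult act_mult V_act_gen hom_V_gen Cons.IH)
  qed
  from this[of "letters w"] show ?case
    by simp
qed (simp add: V_act_add_left act_add_left hom_V_add)

lemma hom_V_supported_from:
  assumes "supported_from m u"
  obtains q where "act (Hx ^ k) (hom_V u) = act (x_poly q) (act (Hx ^ (k + m)) v)"
proof -
  obtain q where q: "x_poly u = x_poly q * (Hx ^ m :: ('g, 'k) free_algebra)"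
    using x_poly_divisible[OF assms] .
  have "Hx ^ k * x_poly u = Hx ^ k * x_poly q * (Hx ^ m :: ('g, 'k) free_algebra)"
    by (simp only: q mult.assoc)
  also have "\<dots> = x_poly q * Hx ^ (k + m)"
    by (simp only: x_poly_commute[symmetric] power_add mult.assoc)
  finally have "act (Hx ^ k * x_poly u) v = act (x_poly q * Hx ^ (k + m)) v"
    by simp
  then show ?thesis
    using that[of q] by (simp only: hom_V_def act_mult v_carrier act_closed)
qed

lemma cyclic_submodule_V_mod:
  "cyclic_submodule (H_alg \<chi> b c) (V_mod \<chi> b c \<rho>) u = range (\<lambda>a. V_act \<chi> b c \<rho> a u)"
  by (auto simp: cyclic_submodule_def H_alg_simps simp flip: V_mod_smult[OF character weight])

lemma supported_from_imp_cyclic: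
  assumes "supported_from m u"
  shows "u \<in> range (\<lambda>a. V_act \<chi> b c \<rho> a (Poly_Mapping.single m 1))"
proof -
  obtain q where "x_poly u = x_poly q * (Hx ^ m :: ('g, 'k) free_algebra)"
    using x_poly_divisible[OF assms] .
  moreover have "Poly_Mapping.single m 1 = V_act \<chi> b c \<rho> (x_poly (Poly_Mapping.single m 1)) (Poly_Mapping.single 0 1)"
    by (simp only: V_act_x_poly)
  ultimately have "u = V_act \<chi> b c \<rho> (x_poly q) (Poly_Mapping.single m 1)"
    using V_act_x_poly[of \<chi> b c \<rho> u] by (simp add: V_act_mult)
  then show ?thesis
    by blast
qed

text \<open>
  Let \<open>x\<^sup>m v\<close> be the last nonzero vector among the \<open>x\<^sup>i v\<close>. Then \<open>0 = y x\<^sup>m\<^sup>+\<^sup>1 v = \<rho>([e]\<^sub>m\<^sub>+\<^sub>1) x\<^sup>m v\<close> forces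
  \<open>\<rho>([e]\<^sub>m\<^sub>+\<^sub>1) = 0\<close>, so that \<open>d\<close> exists and \<open>d \<le> m + 1\<close>. If \<open>x\<^sup>d v\<close> were nonzero, then by simplicity \<open>v\<close>
  would lie in \<open>H x\<^sup>d v\<close>, which is spanned by the \<open>x\<^sup>i v\<close> with \<open>i \<ge> d > 0\<close>; but \<open>x\<^sup>m\<close> kills all of
  these and does not kill \<open>v\<close>. Hence \<open>d = m + 1\<close>.
\<close>

lemma V_dim_eq:
  assumes simple: "simple_module (H_alg \<chi> b c) M"
    and m: "act (Hx ^ m) v \<noteq> \<zero>\<^bsub>M\<^esub>" "act (Hx ^ Suc m) v = \<zero>\<^bsub>M\<^esub>"
  shows "V_dim \<chi> b c \<rho> = Suc m" "bracket (Suc m) = 0"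
proof -
  define d where "d = V_dim \<chi> b c \<rho>"
  have "act (const (bracket (Suc m))) (act (Hx ^ m) v) = \<zero>\<^bsub>M\<^esub>"
    using act_y_pow[of m] m(2) by simp
  then show bracket_m: "bracket (Suc m) = 0"
    using m(1) by (simp add: act_const_eq_0_iff)
  then have d: "d > 0" "bracket d = 0" and "d \<le> Suc m"
    unfolding d_def V_dim_def
    using LeastI[of "\<lambda>d. d > 0 \<and> bracket d = 0" "Suc m"]
      Least_le[of "\<lambda>d. d > 0 \<and> bracket d = 0" "Suc m"] by auto
  have high: "act (Hx ^ j) v = \<zero>\<^bsub>M\<^esub>" if "j \<ge> Suc m" for j
  proof -
    have "(Hx ^ j :: ('g, 'k) free_algebra) = Hx ^ (j - Suc m) * Hx ^ Suc m"
      using that by (simp flip: power_add del: power_Suc)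
    then have "act (Hx ^ j) v = act (Hx ^ (j - Suc m)) (act (Hx ^ Suc m) v)"
      by (metis act_mult v_carrier)
    then show ?thesis
      by (simp add: m(2) del: power_Suc)
  qed
  have "act (Hx ^ d) v = \<zero>\<^bsub>M\<^esub>"
  proof (rule ccontr)
    assume "act (Hx ^ d) v \<noteq> \<zero>\<^bsub>M\<^esub>"
    then obtain a where a: "v = act a (act (Hx ^ d) v)"
      using simple_module_generated[OF simple _ _ v_carrier] by (metis act_closed v_carrier)
    define u where "u = V_act \<chi> b c \<rho> a (Poly_Mapping.single d 1)"
    have "v = hom_V u"
      using a by (simp add: u_def hom_V_act hom_V_single)
    moreover have "supported_from d u"
      unfolding u_def by (rule supported_from_V_act[OF d(2)])
        (simp add: supported_from_def lookup_single when_def)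
    ultimately obtain q where "act (Hx ^ m) v = act (x_poly q) (act (Hx ^ (m + d)) v)"
      using hom_V_supported_from by metis
    then show False
      using m(1) high[of "m + d"] d(1) by simp
  qed
  then have "\<not> d \<le> m"
    using m(1) act_mult[of v "Hx ^ (m - d)" "Hx ^ d"] by (auto simp flip: power_add)
  with \<open>d \<le> Suc m\<close> show "V_dim \<chi> b c \<rho> = Suc m"
    by (simp add: d_def)
qed

text \<open>
  The vectors \<open>v, x v, \<dots>, x\<^sup>m v\<close> are linearly independent: applying \<open>x\<^sup>m\<^sup>-\<^sup>i\<close> to a relation whose first
  nonzero coefficient belongs to \<open>x\<^sup>i v\<close> leaves a nonzero multiple of \<open>x\<^sup>m v\<close>.
\<close>

lemma hom_V_eq_0_iff:
  assumes m: "act (Hx ^ m) v \<noteq> \<zero>\<^bsub>M\<^esub>" "act (Hx ^ Suc m) v = \<zero>\<^bsub>M\<^esub>"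
  shows "hom_V u = \<zero>\<^bsub>M\<^esub> \<longleftrightarrow> supported_from (Suc m) u"
proof
  assume "supported_from (Suc m) u"
  then obtain q where "act (Hx ^ 0) (hom_V u) = act (x_poly q) (act (Hx ^ (0 + Suc m)) v)"
    using hom_V_supported_from by metis
  then show "hom_V u = \<zero>\<^bsub>M\<^esub>"
    by (simp add: m(2) del: power_Suc)
next
  assume u: "hom_V u = \<zero>\<^bsub>M\<^esub>"
  show "supported_from (Suc m) u"
  proof (rule ccontr)
    assume "\<not> supported_from (Suc m) u"
    then obtain j where j: "j < Suc m" "Poly_Mapping.lookup u j \<noteq> 0"
      by (auto simp: supported_from_def)
    define i where "i = (LEAST i. Poly_Mapping.lookup u i \<noteq> 0)"
    have i: "Poly_Mapping.lookup u i \<noteq> 0" "i \<le> m"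
      unfolding i_def using j LeastI[of "\<lambda>i. Poly_Mapping.lookup u i \<noteq> 0" j]
        Least_le[of "\<lambda>i. Poly_Mapping.lookup u i \<noteq> 0" j] by auto
    have below: "Poly_Mapping.lookup u k = 0" if "k < i" for k
      using not_less_Least[of k "\<lambda>i. Poly_Mapping.lookup u i \<noteq> 0"] that by (simp add: i_def)
    define w where "w = u - Poly_Mapping.single i (Poly_Mapping.lookup u i)"
    have "supported_from (Suc i) w"
      using below by (auto simp: supported_from_def w_def lookup_minus lookup_single when_def
        less_Suc_eq)
    then obtain q where "act (Hx ^ (m - i)) (hom_V w) = act (x_poly q) (act (Hx ^ (m - i + Suc i)) v)"
      using hom_V_supported_from by metis
    then have w: "act (Hx ^ (m - i)) (hom_V w) = \<zero>\<^bsub>M\<^esub>"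
      using i(2) m(2) by simp
    have "u = w + Poly_Mapping.single i (Poly_Mapping.lookup u i)"
      by (simp add: w_def)
    then have u_eq: "hom_V u = hom_V w \<oplus>\<^bsub>M\<^esub> act (const (Poly_Mapping.lookup u i)) (act (Hx ^ i) v)"
      by (metis hom_V_add hom_V_single)
    have "\<zero>\<^bsub>M\<^esub> = act (Hx ^ (m - i)) (hom_V u)"
      by (simp add: u)
    also have "\<dots> = act (Hx ^ (m - i)) (hom_V w) \<oplus>\<^bsub>M\<^esub>
        act (Hx ^ (m - i)) (act (const (Poly_Mapping.lookup u i)) (act (Hx ^ i) v))"
      unfolding u_eq by (rule act_add) simp_all
    also have "\<dots> = act (Hx ^ (m - i)) (act (const (Poly_Mapping.lookup u i)) (act (Hx ^ i) v))"
      by (simp add: w)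
    also have "\<dots> = act (const (Poly_Mapping.lookup u i)) (act (Hx ^ (m - i) * Hx ^ i) v)"
      by (simp add: act_const_commute[where a = "Hx ^ k" for k] act_mult)
    also have "\<dots> = act (const (Poly_Mapping.lookup u i)) (act (Hx ^ m) v)"
      using i(2) by (simp flip: power_add)
    finally show False
      using i(1) m(1) by (metis act_closed act_const_eq_0_iff v_carrier)
  qed
qed

text \<open>
  Once \<open>d = m + 1\<close>, both the kernel of \<open>v\<^sub>i \<mapsto> x\<^sup>i v\<close> and \<open>H v\<^sub>d\<close> are the span of the \<open>v\<^sub>i\<close> with
  \<open>i \<ge> d\<close>.
\<close>

lemma isomorphic_Vbar_mod:
  assumes simple: "simple_module (H_alg \<chi> b c) M"
    and torsion: "torsion_module (H_alg \<chi> b c) (H_class \<chi> b c Hx) M"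
  shows "module_isomorphic (H_alg \<chi> b c) M (Vbar_mod \<chi> b c \<rho>)"
proof -
  obtain m where m: "act (Hx ^ m) v \<noteq> \<zero>\<^bsub>M\<^esub>" "act (Hx ^ Suc m) v = \<zero>\<^bsub>M\<^esub>"
    using last_nonzero_power[OF torsion v_carrier v_nonzero] .
  note d = V_dim_eq[OF simple m]
  interpret V: left_module "H_alg \<chi> b c" "V_mod \<chi> b c \<rho>"
    by (rule V_mod_left_module[OF character weight])
  have V_simps: "carrier (V_mod \<chi> b c \<rho>) = UNIV" "u \<oplus>\<^bsub>V_mod \<chi> b c \<rho>\<^esub> w = u + w" for u w
    by (simp_all add: V_mod_def)
  let ?N = "cyclic_submodule (H_alg \<chi> b c) (V_mod \<chi> b c \<rho>) (Poly_Mapping.single (Suc m) 1)"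
  have "supported_from (Suc m) (V_act \<chi> b c \<rho> a (Poly_Mapping.single (Suc m) 1))" for a
    by (rule supported_from_V_act[OF d(2)]) (simp add: supported_from_def lookup_single when_def)
  then have N: "?N = {u. supported_from (Suc m) u}"
    unfolding cyclic_submodule_V_mod using supported_from_imp_cyclic by blast
  have "module_isomorphic (H_alg \<chi> b c) M (quotient_module (V_mod \<chi> b c \<rho>) ?N)"
  proof (rule V.isomorphic_quotient_by_kernel)
    show "submodule ?N (H_alg \<chi> b c) (V_mod \<chi> b c \<rho>)"
      by (rule V.submodule_cyclic) (simp add: V_simps)
    show "?N = {u \<in> carrier (V_mod \<chi> b c \<rho>). hom_V u = \<zero>\<^bsub>M\<^esub>}"
      by (simp add: N V_simps hom_V_eq_0_iff[OF m])
    show "abelian_group M"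
      by (rule M.abelian_group_axioms)
    show "hom_V ` carrier (V_mod \<chi> b c \<rho>) = carrier M"
    proof -
      have "w \<in> range hom_V" if w: "w \<in> carrier M" for w
      proof -
        obtain a where "w = act a v"
          using simple_module_generated[OF simple v_carrier v_nonzero w] .
        then have "w = hom_V (V_act \<chi> b c \<rho> a (Poly_Mapping.single 0 1))"
          using hom_V_single[of 0 1] by (simp add: hom_V_act)
        then show ?thesis
          by blast
      qed
      then show ?thesis
        by (auto simp: V_simps)
    qed
    show "hom_V (a \<odot>\<^bsub>V_mod \<chi> b c \<rho>\<^esub> u) = a \<odot>\<^bsub>M\<^esub> hom_V u" if "a \<in> carrier (H_alg \<chi> b c)" for a u
      using that by (auto simp: H_alg_simps V_mod_smult[OF character weight] hom_V_act act_def)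
  qed (simp add: V_simps hom_V_add)
  then show ?thesis
    by (simp only: Vbar_mod_def d(1))
qed

end

section \<open>Simple torsion modules\<close>

theorem proposition5p10:
  fixes \<chi> :: "'g::ab_group_add \<Rightarrow> 'k::{alg_closed_field, field_char_0}"
    and b c :: 'g
    and n :: nat
    and M :: "(('g, 'k) free_algebra set, 'm) module"
  assumes fin_gen: "\<exists>S::'g set. finite S \<and> group_closure S = UNIV"
    and chi: "\<chi> \<in> carrier character_group"
    and chi_order: "group.ord character_group \<chi> = n" "n > 0"
    and chi_bc: "\<chi> b = \<chi> c"
    and bc: "b + c \<noteq> 0"
    and M_module: "left_module (H_alg \<chi> b c) M"
    and M_fin_dim: "finite_dim_module (\<lambda>r. H_class \<chi> b c (const r)) M"
    and M_simple: "simple_module (H_alg \<chi> b c) M"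
    and M_x_torsion: "torsion_module (H_alg \<chi> b c) (H_class \<chi> b c (gen Xgen)) M"
    and M_y_torsion: "torsion_module (H_alg \<chi> b c) (H_class \<chi> b c (gen Ygen)) M"
  shows "\<exists>\<rho>\<in>carrier character_group.
           module_isomorphic (H_alg \<chi> b c) M (Vbar_mod \<chi> b c \<rho>)"
proof -
  have "is_character \<chi>"
    using chi by (simp add: character_group_def)
  then interpret H_module_alg_closed \<chi> b c M
    by (intro H_module_alg_closed.intro H_module.intro H_module_axioms.intro M_module)
  have "carrier M \<noteq> {\<zero>\<^bsub>M\<^esub>}"
    using M_simple by (simp add: simple_module_def)
  from exists_weight_vector[OF M_fin_dim fin_gen M_y_torsion this]
  obtain v \<rho> where v: "v \<in> carrier M" "v \<noteq> \<zero>\<^bsub>M\<^esub>" "act Hy v = \<zero>\<^bsub>M\<^esub>"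
      "is_character \<rho>" "\<And>g. act (Hg g) v = act (const (\<rho> g)) v"
    by blast
  then interpret weight_vector \<chi> b c M v \<rho>
    by unfold_locales
  show ?thesis
    using isomorphic_Vbar_mod[OF M_simple M_x_torsion] v(4)
    by (auto simp: character_group_def)
qed

end
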